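(* Let $M$ be a hypercomplex subspace of $A$, let $\Omega\subseteq M$ be open and let $f:\Omega\to A$ be of class $\mathcal C^1$. If $A$ is not associative, assume that $f$ and $xf$ are $M$-admissible. Then $f$ is strongly slice-regular on $\Omega$ if and only if it can be extended to a slice-regular function on the symmetric completion $\widetilde\Omega=\bigcup_{x\in\Omega}\mathbb S_x$ of $\Omega$. If this is the case, the extension is unique.
   Context: $A$ is a finite-dimensional real alternative algebra with unity $1\ne0$ (the associator $(x,y,z)=(xy)z-x(yz)$ is alternating), $\mathbb R$ is identified with $\mathbb R\cdot 1$, and $A$ is a *-algebra with real linear anti-involution $x\mapsto x^c$, $(xy)^c=y^cx^c$, $x^c=x$ for $x\in\mathbb R$. Put $t(x)=x+x^c$, $n(x)=xx^c$, $\mathbb S_A=\{J\in A: t(J)=0,\ n(J)=1\}\neq\emptyset$, $\mathbb C_J=\mathrm{span}(1,J)$, $Q_A=\bigcup_{J\in\mathbb S_A}\mathbb C_J$; for $x=\alpha+\beta J\in Q_A$ ($\alpha,\beta\in\mathbb R$, $J\in\mathbb S_A$) put $\mathbb S_x=\alpha+\beta\,\mathbb S_A$. A hypercomplex subspace is a real vector subspace $M$ of $A$ with $\mathbb R\subset M\subset Q_A$ and $\dim(M)>2$; $m=\dim(M)-1$, $S=M\cap\mathbb S_A$. On $M$, $\langle x,y\rangle=\frac12t(xy^c)$ is a scalar product. $\mathcal B=(v_0=1,v_1,\dots,v_m)$ is an orthonormal basis of $M$, $x=\sum_{i=0}^mx_iv_i$, $\partial_i$ is the partial derivative w.r.t.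 $x_i$ of $A$-valued functions (componentwise), $\overline\partial_{\mathcal B}=\frac12(\partial_0+\sum_{i=1}^mv_i\partial_i)$. A $\mathcal C^1$ function $f:\Omega\to A$ is $M$-admissible if $f(x),\overline\partial_{\mathcal B}f(x)\in M$ for all $x\in\Omega$. $xf$ denotes the pointwise product $x\mapsto xf(x)$. Slice-regular functions: let $D\subseteq\mathbb C$ be open and conjugation-invariant, $\Omega_D=\{\alpha+J\beta:\alpha+i\beta\in D,\ J\in\mathbb S_A\}$. A stem function is $F=F_1+\imath F_2:D\to A\otimes_{\mathbb R}\mathbb C$ ($\imath^2=-1$) with $F(\overline z)=\overline{F(z)}$, where $\overline{a+\imath b}=a-\imath b$; it induces the slice function $\mathcal I(F):\Omega_D\to A$, $\alpha+J\beta\mapsto F_1(\alpha+i\beta)+JF_2(\alpha+i\beta)$, which is slice-regular if $F$ is holomorphic w.r.t. left multiplication by $\imath$. Strong slice-regularity: $f\in\mathcal C^1(\Omega)$, $\Omega\subseteq M$ open (not necessarily axially symmetric), is strongly slice-regular if (i) for every $I\in S$ with $\Omega_I:=\Omega\cap\mathbb C_I\ne\emptyset$, the restriction $f|_{\Omega_I}:\Omega_I\to A$ is holomorphic w.r.t. the complex structures given by left multiplication by $I$; and (ii) the functions $\overline\partial_{\mathcal B}f$ and $\overline\partial_{\mathcal B}(xf)$ are zonal, i.e. constant on $\mathbb S_y\cap\Omega$ for every $y\in\Omega$. This does not depend on $\mathcal B$. *)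

theory Defs
  imports "HOL-Analysis.Analysis"
begin

text \<open>
  Finite-dimensional real alternative *-algebras with \<open>1 \<noteq> 0\<close> and non-empty sphere of imaginary
  units. The superclass \<^class>\<open>euclidean_space\<close> says that the underlying real vector space is
  finite-dimensional and supplies its topology; its inner product and norm are auxiliary and not
  related to the multiplication or to the conjugation.
\<close>

class alternative_star_algebra = euclidean_space + times + zero_neq_one +
  fixes conjg :: "'a \<Rightarrow> 'a"
  assumes mult_add_left: "(x + y) * z = x * z + y * z"
    and mult_add_right: "x * (y + z) = x * y + x * z"
    and mult_scale_left: "(r *\<^sub>R x) * y = r *\<^sub>R (x * y)"
    and mult_scale_right: "x * (r *\<^sub>R y) = r *\<^sub>R (x * y)"
    and unit_left: "1 * x = x"
    and unit_right: "x * 1 = x"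
    \<comment> \<open>the associator vanishes whenever two of its arguments coincide\<close>
    and alternative_left: "(x * x) * y = x * (x * y)"
    and alternative_right: "(x * y) * y = x * (y * y)"
    and alternative_flexible: "(x * y) * x = x * (y * x)"
    and conjg_add: "conjg (x + y) = conjg x + conjg y"
    and conjg_scale: "conjg (r *\<^sub>R x) = r *\<^sub>R conjg x"
    and conjg_conjg: "conjg (conjg x) = x"
    and conjg_mult: "conjg (x * y) = conjg y * conjg x"
    and conjg_real: "conjg (r *\<^sub>R 1) = r *\<^sub>R 1"
    and units_exist: "\<exists>J. J + conjg J = 0 \<and> J * conjg J = 1"

definition alg_trace :: "'a::alternative_star_algebra \<Rightarrow> 'a" where
  "alg_trace x = x + conjg x"

definition alg_norm :: "'a::alternative_star_algebra \<Rightarrow> 'a" where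
  "alg_norm x = x * conjg x"

definition imag_units :: "'a::alternative_star_algebra set" where
  "imag_units = {J. alg_trace J = 0 \<and> alg_norm J = 1}"

definition slice_plane :: "'a::alternative_star_algebra \<Rightarrow> 'a set" where
  "slice_plane J = span {1, J}"

definition quadratic_cone :: "'a::alternative_star_algebra set" where
  "quadratic_cone = (\<Union>J\<in>imag_units. slice_plane J)"

definition slice_point :: "'a::alternative_star_algebra \<Rightarrow> complex \<Rightarrow> 'a" where
  "slice_point J z = Re z *\<^sub>R 1 + Im z *\<^sub>R J"

text \<open>The set below does not depend on the representation \<open>x = \<alpha> + \<beta> J\<close>: \<open>\<alpha>\<close> is unique, and \<open>\<beta>\<close> is
  unique up to a sign, which is absorbed by \<open>- imag_units = imag_units\<close>.\<close>

definition sphere_of :: "'a::alternative_star_algebra \<Rightarrow> 'a set" where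
  "sphere_of x =
    {slice_point K z | K J z. J \<in> imag_units \<and> K \<in> imag_units \<and> x = slice_point J z}"

definition symmetric_completion :: "'a::alternative_star_algebra set \<Rightarrow> 'a set" where
  "symmetric_completion \<Omega> = (\<Union>x\<in>\<Omega>. sphere_of x)"

definition hypercomplex_subspace :: "'a::alternative_star_algebra set \<Rightarrow> bool" where
  "hypercomplex_subspace M \<longleftrightarrow>
    subspace M \<and> range (\<lambda>r. r *\<^sub>R 1) \<subseteq> M \<and> M \<subseteq> quadratic_cone \<and> dim M > 2"

text \<open>On a hypercomplex subspace the values of the following form are real, i.e. multiples of \<open>1\<close>.\<close>

definition alg_inner :: "'a::alternative_star_algebra \<Rightarrow> 'a \<Rightarrow> 'a" where
  "alg_inner x y = (1/2) *\<^sub>R alg_trace (x * conjg y)"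

definition orthonormal_basis_of :: "'a::alternative_star_algebra set \<Rightarrow> (nat \<Rightarrow> 'a) \<Rightarrow> bool" where
  "orthonormal_basis_of M v \<longleftrightarrow>
    v 0 = 1 \<and> inj_on v {0..dim M - 1} \<and> independent (v ` {0..dim M - 1}) \<and>
    span (v ` {0..dim M - 1}) = M \<and>
    (\<forall>i\<le>dim M - 1. \<forall>j\<le>dim M - 1. alg_inner (v i) (v j) = (if i = j then 1 else 0))"

text \<open>Functions on a relatively open subset \<open>\<Omega>\<close> of a subspace \<open>M\<close> are represented by total functions
  whose values outside \<open>\<Omega>\<close> are irrelevant; only the restriction of the derivative to \<open>M\<close> is
  determined by the function.\<close>

definition C1_on :: "'a::euclidean_space set \<Rightarrow> ('a \<Rightarrow> 'a) \<Rightarrow> 'a set \<Rightarrow> bool" where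
  "C1_on M f \<Omega> \<longleftrightarrow>
    (\<exists>f'. (\<forall>x\<in>\<Omega>. (f has_derivative f' x) (at x within \<Omega>)) \<and>
          (\<forall>h\<in>M. continuous_on \<Omega> (\<lambda>x. f' x h)))"

definition partial_deriv :: "(nat \<Rightarrow> 'a::euclidean_space) \<Rightarrow> nat \<Rightarrow> ('a \<Rightarrow> 'a) \<Rightarrow> 'a \<Rightarrow> 'a" where
  "partial_deriv v i f x = vector_derivative (\<lambda>s. f (x + s *\<^sub>R v i)) (at 0)"

definition dbar ::
  "'a::alternative_star_algebra set \<Rightarrow> (nat \<Rightarrow> 'a) \<Rightarrow> ('a \<Rightarrow> 'a) \<Rightarrow> 'a \<Rightarrow> 'a" where
  "dbar M v f x =
    (1/2) *\<^sub>R (partial_deriv v 0 f x + (\<Sum>i=1..dim M - 1. v i * partial_deriv v i f x))"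

definition admissible ::
  "'a::alternative_star_algebra set \<Rightarrow> (nat \<Rightarrow> 'a) \<Rightarrow> 'a set \<Rightarrow> ('a \<Rightarrow> 'a) \<Rightarrow> bool" where
  "admissible M v \<Omega> f \<longleftrightarrow> C1_on M f \<Omega> \<and> (\<forall>x\<in>\<Omega>. f x \<in> M \<and> dbar M v f x \<in> M)"

text \<open>Holomorphy on a relatively open subset \<open>U\<close> of a real vector space \<open>V\<close> with complex structure \<open>P\<close>,
  for functions into a space with complex structure \<open>Q\<close>.\<close>

definition holomorphic_wrt ::
  "'u::real_normed_vector set \<Rightarrow> ('u \<Rightarrow> 'u) \<Rightarrow> ('w::real_normed_vector \<Rightarrow> 'w) \<Rightarrow>
    ('u \<Rightarrow> 'w) \<Rightarrow> 'u set \<Rightarrow> bool" where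
  "holomorphic_wrt V P Q f U \<longleftrightarrow>
    (\<forall>x\<in>U. \<exists>f'. (f has_derivative f') (at x within U) \<and> (\<forall>h\<in>V. f' (P h) = Q (f' h)))"

definition circularization :: "complex set \<Rightarrow> 'a::alternative_star_algebra set" where
  "circularization D = {slice_point J z | J z. z \<in> D \<and> J \<in> imag_units}"

text \<open>The complexification of \<open>A\<close> is realised on \<open>A \<times> A\<close>, the pair \<open>(a, b)\<close> standing for
  \<open>a + \<iota> b\<close>.\<close>

definition cplx_i :: "'a::ab_group_add \<times> 'a \<Rightarrow> 'a \<times> 'a" where
  "cplx_i w = (- snd w, fst w)"

definition cplx_conj :: "'a::ab_group_add \<times> 'a \<Rightarrow> 'a \<times> 'a" where
  "cplx_conj w = (fst w, - snd w)"

definition stem_function ::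
  "complex set \<Rightarrow> (complex \<Rightarrow> 'a::alternative_star_algebra \<times> 'a) \<Rightarrow> bool" where
  "stem_function D F \<longleftrightarrow> (\<forall>z\<in>D. F (cnj z) = cplx_conj (F z))"

definition slice_regular_on ::
  "('a::alternative_star_algebra \<Rightarrow> 'a) \<Rightarrow> 'a set \<Rightarrow> bool" where
  "slice_regular_on g W \<longleftrightarrow>
    (\<exists>D F. open D \<and> cnj ` D = D \<and> W = circularization D \<and>
           stem_function D F \<and> holomorphic_wrt UNIV ((*) \<i>) cplx_i F D \<and>
           (\<forall>z\<in>D. \<forall>J\<in>imag_units. g (slice_point J z) = fst (F z) + J * snd (F z)))"

definition zonal_on :: "'a::alternative_star_algebra set \<Rightarrow> ('a \<Rightarrow> 'a) \<Rightarrow> bool" where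
  "zonal_on \<Omega> g \<longleftrightarrow> (\<forall>y\<in>\<Omega>. g constant_on (sphere_of y \<inter> \<Omega>))"

definition strongly_slice_regular ::
  "'a::alternative_star_algebra set \<Rightarrow> (nat \<Rightarrow> 'a) \<Rightarrow> 'a set \<Rightarrow> ('a \<Rightarrow> 'a) \<Rightarrow> bool" where
  "strongly_slice_regular M v \<Omega> f \<longleftrightarrow>
    C1_on M f \<Omega> \<and>
    (\<forall>I\<in>M \<inter> imag_units. \<Omega> \<inter> slice_plane I \<noteq> {} \<longrightarrow>
       holomorphic_wrt (slice_plane I) ((*) I) ((*) I) f (\<Omega> \<inter> slice_plane I)) \<and>
    zonal_on \<Omega> (dbar M v f) \<and> zonal_on \<Omega> (dbar M v (\<lambda>x. x * f x))"

end

theory Submission imports Defs begin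

text \<open>
  If \<open>f\<close> is holomorphic on the slices, then with \<open>m = dim M - 1\<close>
  \<open>\<partial>(xf) - x\<^sup>c \<partial>f = (1-m)/2 f\<close>, where \<open>\<partial>\<close> is the Cauchy-Riemann operator \<open>dbar\<close>.
  Hence, if \<open>\<partial>f = a\<close> and \<open>\<partial>(xf) = b\<close> are constant on the part of a
  sphere inside \<open>\<Omega>\<close>, then \<open>f(\<alpha> + \<beta>J) = F\<^sub>1 + J F\<^sub>2\<close> there, with \<open>F\<^sub>1 = 2/(1-m) (b - \<alpha> a)\<close> and
  \<open>F\<^sub>2 = 2/(1-m) \<beta> a\<close>. Two different units of \<open>M\<close> determine \<open>F\<^sub>1\<close> and \<open>F\<^sub>2\<close> from \<open>f\<close>, because
  nonzero elements of \<open>M\<close> are invertible; this gives holomorphy of \<open>F\<close> and uniqueness. Conversely,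
  for a slice function the derivatives tangent to the sphere are explicit and give
  \<open>\<partial>f = (1-m)/(2\<beta>) F\<^sub>2\<close>, which is zonal, and the identity then makes \<open>\<partial>(xf)\<close> zonal as well.
\<close>

section \<open>Algebra\<close>

lemma bilinear_alg_mult: "bilinear ((*) :: 'a::alternative_star_algebra \<Rightarrow> 'a \<Rightarrow> 'a)"
  unfolding bilinear_def
  by (auto intro!: linearI simp: mult_add_left mult_add_right mult_scale_left mult_scale_right)

interpretation alg_mult: bounded_bilinear "(*) :: 'a::alternative_star_algebra \<Rightarrow> 'a \<Rightarrow> 'a"
  using bilinear_alg_mult bilinear_conv_bounded_bilinear by blast

text \<open>Polarization of the left alternative law in its repeated argument. It replaces
  associativity wherever two left factors have to change places.\<close>

lemma alternative_left_linearized: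
  fixes x y z :: "'a::alternative_star_algebra"
  shows "x * (y * z) + y * (x * z) = (x * y + y * x) * z"
proof -
  have "((x + y) * (x + y)) * z = (x + y) * ((x + y) * z)"
    by (rule alternative_left)
  then show ?thesis
    by (simp add: mult_add_left mult_add_right alternative_left add_ac)
qed

lemma conjg_minus: "conjg (- x :: 'a::alternative_star_algebra) = - conjg x"
  using conjg_scale[of "-1" x] by simp

lemma conjg_one [simp]: "conjg (1::'a::alternative_star_algebra) = 1"
  using conjg_real[of 1, where 'a='a] by simp

lemma imag_unitsD:
  assumes "J \<in> imag_units"
  shows "conjg J = - J" "J * J = - 1" "J * (J * y) = - y"
proof -
  show c: "conjg J = - J"
    using assms by (simp add: imag_units_def alg_trace_def eq_neg_iff_add_eq_0 add.commute)
  show "J * J = - 1"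
    using assms by (simp add: imag_units_def alg_norm_def c alg_mult.minus_right eq_neg_iff_add_eq_0
      neg_eq_iff_add_eq_0 add.commute)
  then show "J * (J * y) = - y"
    by (simp add: alternative_left[symmetric] alg_mult.minus_left unit_left)
qed

lemma imag_unitsI: "conjg J = - J \<Longrightarrow> J * J = - 1 \<Longrightarrow> J \<in> imag_units"
  by (simp add: imag_units_def alg_trace_def alg_norm_def alg_mult.minus_right)

lemma imag_units_minus: "J \<in> imag_units \<Longrightarrow> - J \<in> imag_units"
  by (rule imag_unitsI) (simp_all add: imag_unitsD conjg_minus alg_mult.minus_left alg_mult.minus_right)

section \<open>Points of the slices and the ambiguity of their coordinates\<close>

lemma conjg_slice_point:
  "J \<in> imag_units \<Longrightarrow> conjg (slice_point J z) = slice_point J (cnj z)"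
  by (simp add: slice_point_def conjg_add conjg_scale imag_unitsD)

lemma slice_point_minus: "slice_point (- J) z = slice_point J (cnj z)"
  by (simp add: slice_point_def)

text \<open>Squaring both sides of the assumed equality removes the units, since each has square
  \<open>- 1\<close>; this leaves \<open>r * r = s * s\<close>, and the sign of \<open>s\<close>
  then decides how \<open>K\<close> is related to \<open>J\<close>.\<close>

lemma scaleR_imag_unit_eq:
  fixes J K :: "'a::alternative_star_algebra"
  assumes "J \<in> imag_units" "K \<in> imag_units" "r *\<^sub>R J = s *\<^sub>R K"
  shows "s = r \<and> (r = 0 \<or> K = J) \<or> s = - r \<and> K = - J"
proof -
  have "(r *\<^sub>R J) * (r *\<^sub>R J) = (s *\<^sub>R K) * (s *\<^sub>R K)"
    using assms by simp
  then have "(r * r) *\<^sub>R (1::'a) = (s * s) *\<^sub>R 1"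
    using assms(1,2) by (simp only: mult_scale_left mult_scale_right imag_unitsD scaleR_scaleR
      scaleR_minus_right neg_equal_iff_equal)
  then have "r * r = s * s" by simp
  then consider "s = r" | "s = - r" by (metis square_eq_iff)
  then show ?thesis
  proof cases
    case 1
    then show ?thesis using assms(3) by auto
  next
    case 2
    then have "r *\<^sub>R J = r *\<^sub>R (- K)" using assms(3) by simp
    then have "r = 0 \<or> J = - K" by (auto simp only: scaleR_cancel_left)
    then show ?thesis using 2 by auto
  qed
qed

text \<open>Adding the conjugate isolates the real part, so only real multiples of two units remain
  to be compared. The ambiguity is exactly simultaneous conjugation of the coordinate and negation
  of the unit, plus a free unit at real points.\<close>

lemma slice_point_eqD:
  fixes J K :: "'a::alternative_star_algebra"
  assumes "J \<in> imag_units" "K \<in> imag_units" "slice_point J z = slice_point K w"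
  shows "w = z \<and> (Im z = 0 \<or> K = J) \<or> w = cnj z \<and> K = - J"
proof -
  have "slice_point J z + conjg (slice_point J z) = slice_point K w + conjg (slice_point K w)"
    using assms by simp
  then have "slice_point J z + slice_point J (cnj z) = slice_point K w + slice_point K (cnj w)"
    by (simp only: conjg_slice_point[OF assms(1)] conjg_slice_point[OF assms(2)])
  then have "2 *\<^sub>R (Re z *\<^sub>R (1::'a)) = 2 *\<^sub>R (Re w *\<^sub>R 1)"
    unfolding scaleR_2 by (simp add: slice_point_def)
  then have re: "Re w = Re z" by simp
  then have "Im z *\<^sub>R J = Im w *\<^sub>R K"
    using assms(3) by (simp add: slice_point_def)
  from scaleR_imag_unit_eq[OF assms(1,2) this] show ?thesis
    unfolding complex_eq_iff[of w] using re by simp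
qed

lemma slice_point_mult_i:
  "J \<in> imag_units \<Longrightarrow> slice_point J (\<i> * z) = J * slice_point J z"
  by (simp add: slice_point_def mult_add_right mult_scale_right imag_unitsD unit_right)

lemma bounded_linear_slice_point: "bounded_linear (slice_point J)"
  unfolding slice_point_def
  by (intro bounded_linear_add bounded_linear_scaleR_const bounded_linear_Re bounded_linear_Im)

lemma slice_plane_eq: "slice_plane J = range (slice_point J)"
proof -
  have "x \<in> span {1, J} \<longleftrightarrow> (\<exists>z. x = slice_point J z)" for x :: 'a
  proof
    assume "x \<in> span {1, J}"
    then obtain a b where "x = a *\<^sub>R 1 + b *\<^sub>R J"
      by (auto simp: span_breakdown_eq span_singleton algebra_simps)
    then show "\<exists>z. x = slice_point J z"
      by (intro exI[of _ "Complex a b"]) (simp add: slice_point_def)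
  next
    assume "\<exists>z. x = slice_point J z"
    then show "x \<in> span {1, J}"
      by (auto simp: slice_point_def intro!: span_add span_scale intro: span_base)
  qed
  then show ?thesis by (auto simp: slice_plane_def)
qed

lemma slice_point_mem_circularization:
  assumes "cnj ` D = D" "J \<in> imag_units" "slice_point J z \<in> circularization D"
  shows "z \<in> D"
proof -
  obtain K w where "w \<in> D" "K \<in> imag_units" "slice_point K w = slice_point J z"
    using assms(3) by (auto simp: circularization_def)
  then show ?thesis
    using slice_point_eqD[of K J w z] assms(1,2) by auto
qed

lemma symmetric_completion_eq_circularization:
  "symmetric_completion \<Omega> = circularization {z. \<exists>J\<in>imag_units. slice_point J z \<in> \<Omega>}"
  unfolding symmetric_completion_def circularization_def sphere_of_def by blast

text \<open>\<open>sphere_of\<close> ranges over all representations of its centre. Another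
  representation has coordinate \<open>z\<close> or \<open>cnj z\<close>, and in the second case
  replacing \<open>K\<close> by \<open>- K\<close> restores the prescribed \<open>z\<close>.\<close>

lemma sphere_ofE:
  assumes "x \<in> sphere_of (slice_point J z)" "J \<in> imag_units"
  obtains K where "K \<in> imag_units" "x = slice_point K z"
proof -
  obtain K J' w where *: "x = slice_point K w" "J' \<in> imag_units" "K \<in> imag_units"
      "slice_point J z = slice_point J' w"
    using assms(1) unfolding sphere_of_def by blast
  consider "w = z" | "w = cnj z"
    using slice_point_eqD[OF assms(2) *(2) *(4)] by blast
  then show ?thesis
  proof cases
    case 1
    then show ?thesis using that * by blast
  next
    case 2
    then have "x = slice_point (- K) z" unfolding *(1) slice_point_minus by simp
    then show ?thesis using that[OF imag_units_minus[OF *(3)]] by blast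
  qed
qed

text \<open>The relation \<open>P\<close> is the graph of the induced function. It is single-valued
  because the stem condition makes the first component even and the second odd under conjugation,
  which matches the ambiguity of slice coordinates.\<close>

lemma stem_function_induces:
  assumes "stem_function D F"
  obtains g where "\<And>z J. z \<in> D \<Longrightarrow> J \<in> imag_units \<Longrightarrow>
    g (slice_point J z) = fst (F z) + J * snd (F z)"
proof -
  define P where "P x y \<longleftrightarrow> (\<exists>z\<in>D. \<exists>J\<in>imag_units. x = slice_point J z \<and> y = fst (F z) + J * snd (F z))"
    for x y
  have wd: "fst (F z) + J * snd (F z) = fst (F w) + K * snd (F w)"
    if "z \<in> D" and JK: "J \<in> imag_units" "K \<in> imag_units" "slice_point J z = slice_point K w"
    for z w J K
  proof -
    have st: "F (cnj z) = (fst (F z), - snd (F z))"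
      using assms \<open>z \<in> D\<close> unfolding stem_function_def cplx_conj_def by blast
    \<comment> \<open>At a real point the unit is arbitrary, so its coefficient has to vanish;
      oddness forces this.\<close>
    have real: "snd (F z) = 0" if "Im z = 0"
    proof -
      have "cnj z = z" using that by (simp add: complex_eq_iff)
      then have "snd (F z) = - snd (F z)" using arg_cong[OF st, of snd] by simp
      then have "2 *\<^sub>R snd (F z) = 0" unfolding scaleR_2 eq_neg_iff_add_eq_0 .
      then show ?thesis by simp
    qed
    consider "w = z" "Im z = 0" | "w = z" "K = J" | "w = cnj z" "K = - J"
      using slice_point_eqD[OF JK] by blast
    then show ?thesis
    proof cases
      case 1
      then show ?thesis by (simp add: real alg_mult.zero_right)
    next
      case 2
      then show ?thesis by simp
    next
      case 3
      then show ?thesis by (simp add: st alg_mult.minus_left alg_mult.minus_right)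
    qed
  qed
  have "(THE y. P (slice_point J z) y) = fst (F z) + J * snd (F z)"
    if "z \<in> D" "J \<in> imag_units" for z J
  proof (rule the_equality)
    show "P (slice_point J z) (fst (F z) + J * snd (F z))"
      unfolding P_def using that by blast
    fix y
    assume "P (slice_point J z) y"
    then obtain w K where "K \<in> imag_units" "slice_point J z = slice_point K w"
        and y: "y = fst (F w) + K * snd (F w)"
      unfolding P_def by blast
    then show "y = fst (F z) + J * snd (F z)"
      using wd[OF that, of K w] by simp
  qed
  then show ?thesis by (rule that)
qed

lemma zonal_onD:
  assumes "zonal_on \<Omega> g" "J \<in> imag_units" "K \<in> imag_units"
    and "slice_point J z \<in> \<Omega>" "slice_point K z \<in> \<Omega>"
  shows "g (slice_point J z) = g (slice_point K z)"
proof -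
  have "slice_point J z \<in> sphere_of (slice_point J z) \<inter> \<Omega>"
    and "slice_point K z \<in> sphere_of (slice_point J z) \<inter> \<Omega>"
    using assms(2-5) unfolding sphere_of_def by blast+
  then show ?thesis
    using assms(1,4) unfolding zonal_on_def constant_on_def by metis
qed

section \<open>Derivatives along a relatively open set\<close>

lemma openin_vimage_neighbourhood:
  assumes "openin (top_of_set S) U" "\<And>s. \<gamma> s \<in> S" "continuous_on UNIV \<gamma>" "\<gamma> t \<in> U"
  shows "\<exists>N. open N \<and> t \<in> N \<and> (\<forall>s\<in>N. \<gamma> s \<in> U)"
proof -
  obtain T where "open T" "U = S \<inter> T"
    using assms(1) by (auto simp: openin_open)
  then show ?thesis
    using assms open_vimage[OF _ assms(3), of T] by (intro exI[of _ "\<gamma> -` T"]) auto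
qed

text \<open>\<open>U\<close> is open only relative to \<open>S\<close>, so \<open>f\<close> has
  merely a derivative within \<open>U\<close>. A map with values in \<open>S\<close> stays in
  \<open>U\<close> for parameters near \<open>t\<close>, hence the composite has a full derivative
  there.\<close>

lemma has_derivative_compose_openin:
  fixes \<gamma> :: "'b::real_normed_vector \<Rightarrow> 'a::real_normed_vector"
  assumes "openin (top_of_set S) U" "\<And>s. \<gamma> s \<in> S" "continuous_on UNIV \<gamma>"
    and "(\<gamma> has_derivative \<gamma>') (at t)" "\<gamma> t \<in> U" "(f has_derivative f') (at (\<gamma> t) within U)"
  shows "((\<lambda>s. f (\<gamma> s)) has_derivative (\<lambda>h. f' (\<gamma>' h))) (at t)"
proof -
  obtain N where N: "open N" "t \<in> N" "\<And>s. s \<in> N \<Longrightarrow> \<gamma> s \<in> U"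
    using openin_vimage_neighbourhood[OF assms(1) assms(2) assms(3) assms(5)] by blast
  have "(f has_derivative f') (at (\<gamma> t) within \<gamma> ` N)"
    using assms(6) by (rule has_derivative_subset) (use N in auto)
  with has_derivative_at_withinI[OF assms(4)] have "(f \<circ> \<gamma> has_derivative f' \<circ> \<gamma>') (at t within N)"
    by (rule diff_chain_within)
  then show ?thesis
    unfolding at_within_open[OF N(2,1)] comp_def .
qed

lemma has_derivative_slice_point:
  assumes "openin (top_of_set S) U" "slice_plane J \<subseteq> S" "slice_point J z \<in> U"
    and "(f has_derivative f') (at (slice_point J z) within U)"
  shows "((\<lambda>w. f (slice_point J w)) has_derivative (\<lambda>h. f' (slice_point J h))) (at z)"
proof (rule has_derivative_compose_openin[OF assms(1), where \<gamma> = "slice_point J"])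
  show "continuous_on UNIV (slice_point J)"
    by (rule linear_continuous_on[OF bounded_linear_slice_point])
  show "(slice_point J has_derivative slice_point J) (at z)"
    using bounded_linear_slice_point by (rule bounded_linear_imp_has_derivative)
qed (use assms in \<open>auto simp: slice_plane_eq\<close>)

text \<open>\<open>partial_deriv\<close> differentiates a total function along a line. Because
  \<open>v i\<close> lies in \<open>M\<close>, the line runs inside \<open>\<Omega>\<close> for
  small parameters, where the derivative within \<open>\<Omega>\<close> governs it.\<close>

lemma partial_deriv_eq:
  assumes "openin (top_of_set M) \<Omega>" "subspace M" "x \<in> \<Omega>" "v i \<in> M"
    and "(f has_derivative f') (at x within \<Omega>)"
  shows "partial_deriv v i f x = f' (v i)"
proof -
  have "x \<in> M" using assms(1,3) openin_imp_subset by blast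
  have "((\<lambda>s. f (x + s *\<^sub>R v i)) has_derivative (\<lambda>h. f' (h *\<^sub>R v i))) (at 0)"
  proof (rule has_derivative_compose_openin[OF assms(1), where \<gamma> = "\<lambda>s. x + s *\<^sub>R v i"
      and \<gamma>' = "\<lambda>h. h *\<^sub>R v i" and f' = f' and f = f])
    show "x + s *\<^sub>R v i \<in> M" for s
      using \<open>x \<in> M\<close> assms by (simp add: subspace_add subspace_scale)
    show "((\<lambda>s. x + s *\<^sub>R v i) has_derivative (\<lambda>h. h *\<^sub>R v i)) (at 0)"
      by (auto intro!: derivative_eq_intros)
  qed (use assms in \<open>auto intro!: continuous_intros\<close>)
  then have "((\<lambda>s. f (x + s *\<^sub>R v i)) has_vector_derivative f' (v i)) (at 0)"
    using has_derivative_linear[OF assms(5)] by (simp add: has_vector_derivative_def linear_cmul)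
  then show ?thesis
    unfolding partial_deriv_def by (rule vector_derivative_at)
qed

section \<open>Imaginary units of a hypercomplex subspace\<close>

text \<open>Anticommutation kills the mixed term of the square, and the rest is the Pythagorean
  identity. This gives a great circle of units through \<open>J\<close> in direction
  \<open>K\<close>.\<close>

lemma rotated_imag_unit:
  assumes "J \<in> imag_units" "K \<in> imag_units" "J * K + K * J = 0"
  shows "cos t *\<^sub>R J + sin t *\<^sub>R K \<in> imag_units" (is "?L \<in> _")
proof (rule imag_unitsI)
  show "conjg ?L = - ?L"
    using assms(1,2) by (simp add: conjg_add conjg_scale imag_unitsD)
  have "?L * ?L = (cos t * cos t) *\<^sub>R (J * J) + (cos t * sin t) *\<^sub>R (J * K + K * J)
      + (sin t * sin t) *\<^sub>R (K * K)"
    by (simp add: mult_add_left mult_add_right mult_scale_left mult_scale_right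
        scaleR_add_right mult.commute[of "sin t" "cos t"])
  also have "\<dots> = - ((cos t * cos t + sin t * sin t) *\<^sub>R 1)"
    unfolding assms(3) imag_unitsD(2)[OF assms(1)] imag_unitsD(2)[OF assms(2)] scaleR_add_left
    by simp
  finally show "?L * ?L = - 1" unfolding sin_cos_squared_add3 by simp
qed

text \<open>Equality would make \<open>K\<close> a multiple of \<open>J\<close>, hence equal to
  \<open>J\<close> or \<open>- J\<close>; anticommutation would then give
  \<open>J * J + J * J = 0\<close>, contrary to \<open>J * J = - 1\<close>.\<close>

lemma rotated_imag_unit_neq:
  assumes "J \<in> imag_units" "K \<in> imag_units" "J * K + K * J = 0" "sin t \<noteq> 0"
  shows "cos t *\<^sub>R J + sin t *\<^sub>R K \<noteq> J"
proof
  assume "cos t *\<^sub>R J + sin t *\<^sub>R K = J"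
  then have "(1 - cos t) *\<^sub>R J = sin t *\<^sub>R K"
    by (simp add: scaleR_diff_left diff_eq_eq add.commute)
  then have "K = J \<or> K = - J"
    using scaleR_imag_unit_eq[OF assms(1,2), of "1 - cos t" "sin t"] assms(4) by auto
  then have "J * J + J * J = 0"
  proof
    assume "K = - J"
    then have "- (J * J) + - (J * J) = 0"
      using assms(3) by (simp only: alg_mult.minus_left alg_mult.minus_right)
    then show ?thesis by (simp only: minus_add_distrib[symmetric] neg_equal_0_iff_equal)
  qed (use assms(3) in simp)
  then have "2 *\<^sub>R (J * J) = 0"
    by (simp only: scaleR_2)
  then show False
    using assms(1) by (simp add: imag_unitsD)
qed

locale hypercomplex =
  fixes M :: "'a::alternative_star_algebra set" and v :: "nat \<Rightarrow> 'a"
  assumes hypercomplex: "hypercomplex_subspace M"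
    and orthonormal: "orthonormal_basis_of M v"
begin

abbreviation m :: nat where "m \<equiv> dim M - 1"

lemma m_ge_2: "m \<ge> 2"
  using hypercomplex unfolding hypercomplex_subspace_def by linarith

lemma subspace_M: "subspace M"
  using hypercomplex by (simp add: hypercomplex_subspace_def)

lemma one_mem: "1 \<in> M"
proof -
  have "1 *\<^sub>R 1 \<in> M"
    using hypercomplex unfolding hypercomplex_subspace_def by blast
  then show ?thesis by simp
qed

lemma basis_mem: "i \<le> m \<Longrightarrow> v i \<in> M"
  using orthonormal span_base[of "v i" "v ` {0..m}"] unfolding orthonormal_basis_of_def by auto

lemma basis_zero: "v 0 = 1"
  using orthonormal unfolding orthonormal_basis_of_def by blast

lemma conjg_basis:
  assumes "i \<in> {1..m}"
  shows "conjg (v i) = - v i"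
proof -
  have "alg_inner (v i) (v 0) = 0"
    using orthonormal assms unfolding orthonormal_basis_of_def atLeastAtMost_iff
    by (metis One_nat_def le0 not_one_le_zero)
  then show ?thesis
    by (simp add: alg_inner_def alg_trace_def basis_zero unit_right eq_neg_iff_add_eq_0 add.commute)
qed

lemma basis_anticommute:
  assumes "i \<in> {1..m}" "j \<in> {1..m}"
  shows "v i * v j + v j * v i = (if i = j then - 2 else 0) *\<^sub>R 1"
proof -
  have "alg_inner (v i) (v j) = (if i = j then 1 else 0)"
    using orthonormal assms unfolding orthonormal_basis_of_def by auto
  then have "(- 2) *\<^sub>R alg_inner (v i) (v j) = (if i = j then - 2 else 0) *\<^sub>R 1"
    by simp
  moreover have "(- 2) *\<^sub>R alg_inner (v i) (v j) = v i * v j + v j * v i"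
    by (simp add: alg_inner_def alg_trace_def conjg_basis[OF assms(1)] conjg_basis[OF assms(2)]
        alg_mult.minus_right alg_mult.minus_left conjg_minus conjg_mult add.commute)
  ultimately show ?thesis by simp
qed

lemma basis_imag_unit:
  assumes "i \<in> {1..m}"
  shows "v i \<in> imag_units"
proof (rule imag_unitsI)
  have "2 *\<^sub>R (v i * v i) = 2 *\<^sub>R (- 1)"
    using basis_anticommute[OF assms assms] by (simp add: scaleR_2)
  then show "v i * v i = - 1" by (simp only: scaleR_cancel_left) simp
qed (rule conjg_basis[OF assms])

lemma slice_plane_subset: "J \<in> M \<Longrightarrow> slice_plane J \<subseteq> M"
  unfolding slice_plane_def using one_mem subspace_M by (intro span_minimal) auto

lemma slice_point_mem: "J \<in> M \<Longrightarrow> slice_point J z \<in> M"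
  using slice_plane_subset slice_plane_eq by blast

lemma imag_unit_mem:
  assumes "slice_point J z \<in> M" "Im z \<noteq> 0"
  shows "J \<in> M"
proof -
  have "inverse (Im z) *\<^sub>R (slice_point J z - Re z *\<^sub>R 1) \<in> M"
    using assms subspace_M one_mem by (intro subspace_scale subspace_diff) auto
  then show ?thesis using assms(2) by (simp add: slice_point_def)
qed

text \<open>Distinct imaginary basis vectors anticommute, so the anticommutator with
  \<open>v i\<close> reads off the coefficient \<open>c i\<close>. Both facts come with the same
  \<open>c\<close>, because the computations of \<open>dbar\<close> move \<open>v i\<close> past an
  imaginary unit and afterwards reassemble that unit from its coefficients.\<close>

lemma imaginary_expansion:
  assumes "w \<in> M" "conjg w = - w"
  shows "\<exists>c. w = (\<Sum>i=1..m. c i *\<^sub>R v i) \<and>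
    (\<forall>i\<in>{1..m}. v i * w + w * v i = (- 2 * c i) *\<^sub>R 1)"
proof -
  have "span (v ` {0..m}) = M" "inj_on v {0..m}"
    using orthonormal unfolding orthonormal_basis_of_def by simp_all
  then have "w \<in> span (v ` {0..m})"
    using assms(1) by simp
  then have "w \<in> range (\<lambda>u. \<Sum>x\<in>v ` {0..m}. u x *\<^sub>R x)"
    by (simp only: span_finite finite_imageI finite_atLeastAtMost)
  then obtain u where "w = (\<Sum>x\<in>v ` {0..m}. u x *\<^sub>R x)"
    by (rule imageE)
  then have "w = (\<Sum>i=0..m. u (v i) *\<^sub>R v i)"
    using \<open>inj_on v {0..m}\<close> by (simp only: sum.reindex comp_def)
  also have "\<dots> = u (v 0) *\<^sub>R v 0 + (\<Sum>i=Suc 0..m. u (v i) *\<^sub>R v i)"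
    by (rule sum.atLeast_Suc_atMost) simp
  finally have w: "w = u 1 *\<^sub>R 1 + (\<Sum>i=1..m. u (v i) *\<^sub>R v i)"
    by (simp add: basis_zero)
  have lin: "linear (conjg :: 'a \<Rightarrow> 'a)"
    by (rule linearI) (simp_all add: conjg_add conjg_scale)
  have "conjg (\<Sum>i=1..m. u (v i) *\<^sub>R v i) = (\<Sum>i=1..m. - (u (v i) *\<^sub>R v i))"
    unfolding linear_sum[OF lin] by (intro sum.cong) (auto simp: conjg_scale conjg_basis)
  then have "conjg w = u 1 *\<^sub>R 1 - (\<Sum>i=1..m. u (v i) *\<^sub>R v i)"
    by (subst w) (simp only: conjg_add conjg_real sum_negf diff_conv_add_uminus)
  \<comment> \<open>The trace sees only the coefficient of \<open>v 0 = 1\<close>, which therefore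
    vanishes for imaginary \<open>w\<close>.\<close>
  then have "w + conjg w = 2 *\<^sub>R (u 1 *\<^sub>R 1)"
    unfolding scaleR_2 by (subst w) simp
  then have "u 1 = 0" using assms(2) by simp
  with w have w: "w = (\<Sum>i=1..m. u (v i) *\<^sub>R v i)" by simp
  moreover have "v i * w + w * v i = (- 2 * u (v i)) *\<^sub>R 1" if "i \<in> {1..m}" for i
  proof -
    have "v i * w + w * v i = (\<Sum>j=1..m. u (v j) *\<^sub>R (v i * v j + v j * v i))"
      by (subst (1 2) w) (simp only: alg_mult.sum_left alg_mult.sum_right mult_scale_left
          mult_scale_right scaleR_add_right sum.distrib)
    also have "\<dots> = (\<Sum>j=1..m. if i = j then (- 2 * u (v j)) *\<^sub>R 1 else 0)"
      using that by (intro sum.cong) (auto simp: basis_anticommute)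
    also have "\<dots> = (- 2 * u (v i)) *\<^sub>R 1"
      using that by (simp add: sum.delta)
    finally show ?thesis .
  qed
  ultimately show ?thesis by (intro exI[of _ "\<lambda>i. u (v i)"]) blast
qed

text \<open>Membership in the quadratic cone puts \<open>w\<close> in some slice plane, and its
  vanishing trace removes the real part. So normalization needs no norm on \<open>M\<close>: the
  cone supplies the unit.\<close>

lemma imaginary_normalize:
  assumes "w \<in> M" "conjg w = - w" "w \<noteq> 0"
  obtains r K where "r \<noteq> 0" "K \<in> M \<inter> imag_units" "w = r *\<^sub>R K"
proof -
  have "w \<in> quadratic_cone"
    using hypercomplex assms(1) by (auto simp: hypercomplex_subspace_def)
  then obtain K z where K: "K \<in> imag_units" and w: "w = slice_point K z"
    by (auto simp: quadratic_cone_def slice_plane_eq)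
  have "slice_point K z + slice_point K (cnj z) = 0"
    using assms(2) K by (simp add: w conjg_slice_point)
  then have "2 *\<^sub>R (Re z *\<^sub>R (1::'a)) = 0"
    unfolding scaleR_2 by (simp add: slice_point_def)
  then have w': "w = Im z *\<^sub>R K"
    by (simp add: w slice_point_def)
  with assms(3) have "Im z \<noteq> 0" by auto
  with imag_unit_mem[of K z] w assms(1) K w' that show ?thesis by blast
qed

text \<open>A Gram-Schmidt step applied to \<open>v 1\<close> and \<open>J\<close>. If
  \<open>v 1\<close> is parallel to \<open>J\<close>, then \<open>v 2\<close> is already orthogonal
  to \<open>J\<close>; it is available because \<open>m \<ge> 2\<close>.\<close>

lemma orthogonal_imag_unit:
  assumes "J \<in> M \<inter> imag_units"
  obtains K where "K \<in> M \<inter> imag_units" "J * K + K * J = 0"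
proof -
  have J: "J \<in> M" "conjg J = - J" "J * J = - 1"
    using assms by (auto simp: imag_unitsD)
  have i: "1 \<in> {1..m}" "2 \<in> {1..m}" using m_ge_2 by auto
  obtain c where "v 1 * J + J * v 1 = (- 2 * c) *\<^sub>R 1"
    using imaginary_expansion[OF J(1,2)] i(1) by blast
  \<comment> \<open>The anticommutator of \<open>v 1\<close> with \<open>J\<close> is
    \<open>- 2 * c\<close> and that of \<open>J\<close> with itself is \<open>- 2\<close>, so
    subtracting \<open>c\<close> times \<open>J\<close> makes the result anticommute with
    \<open>J\<close>.\<close>
  define w where "w = v 1 - c *\<^sub>R J"
  have w: "w \<in> M" "conjg w = - w"
    using J subspace_M basis_mem[of 1] i(1) conjg_basis[OF i(1)]
      conjg_add[of "v 1" "- (c *\<^sub>R J)"] by (auto simp: w_def subspace_diff subspace_scale conjg_minus conjg_scale)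
  have "J * w + w * J = (v 1 * J + J * v 1) - c *\<^sub>R (J * J + J * J)"
    by (simp add: w_def alg_mult.diff_left alg_mult.diff_right mult_scale_left mult_scale_right
        scaleR_add_right)
  also have "\<dots> = 0"
    unfolding \<open>v 1 * J + J * v 1 = _\<close> J(3) by (simp add: scaleR_2[symmetric] flip: scaleR_minus_right)
  finally have Jw: "J * w + w * J = 0" .
  show ?thesis
  proof (cases "w = 0")
    case True
    then have v1: "v 1 = c *\<^sub>R J" by (simp add: w_def)
    have "c \<noteq> 0"
    proof
      assume "c = 0"
      then show False using v1 imag_unitsD(2)[OF basis_imag_unit[OF i(1)]]
        by (simp add: alg_mult.zero_left)
    qed
    have "v 1 * v 2 + v 2 * v 1 = 0"
      using basis_anticommute[OF i] by simp
    then have "c *\<^sub>R (J * v 2 + v 2 * J) = 0"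
      unfolding v1 by (simp add: mult_scale_left mult_scale_right scaleR_add_right)
    with \<open>c \<noteq> 0\<close> have "J * v 2 + v 2 * J = 0" by simp
    then show ?thesis using that[of "v 2"] i(2) basis_mem[of 2] basis_imag_unit[OF i(2)] by auto
  next
    case False
    then obtain r K where K: "r \<noteq> 0" "K \<in> M \<inter> imag_units" "w = r *\<^sub>R K"
      using imaginary_normalize[OF w] by metis
    then have "r *\<^sub>R (J * K + K * J) = 0"
      using Jw by (simp add: mult_scale_left mult_scale_right scaleR_add_right)
    with \<open>r \<noteq> 0\<close> have "J * K + K * J = 0" by simp
    then show ?thesis using K(2) that by blast
  qed
qed

text \<open>The difference is a nonzero imaginary element of \<open>M\<close>, hence a real multiple
  of a unit. Left multiplication by it therefore squares to a nonzero scalar, which provides an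
  inverse operator even without associativity.\<close>

lemma imag_unit_diff_square:
  assumes "J \<in> M \<inter> imag_units" "K \<in> M \<inter> imag_units" "J \<noteq> K"
  obtains r where "r \<noteq> 0" "\<And>y. (J - K) * ((J - K) * y) = r *\<^sub>R y"
proof -
  have "conjg (J - K) = - (J - K)"
    using assms conjg_add[of J "- K"] by (simp add: conjg_minus imag_unitsD)
  then obtain r L where L: "r \<noteq> 0" "L \<in> M \<inter> imag_units" "J - K = r *\<^sub>R L"
    using imaginary_normalize[of "J - K"] assms subspace_M by (auto simp: subspace_diff)
  then have "(J - K) * ((J - K) * y) = (- (r * r)) *\<^sub>R y" for y
    by (simp add: mult_scale_left mult_scale_right imag_unitsD)
  then show ?thesis using that[of "- (r * r)"] \<open>r \<noteq> 0\<close> by simp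
qed

text \<open>Subtracting the two equations leaves \<open>(J - K) * (b - b') = 0\<close>, and left
  multiplication by \<open>J - K\<close> is injective.\<close>

lemma stem_values_unique:
  assumes "J \<in> M \<inter> imag_units" "K \<in> M \<inter> imag_units" "J \<noteq> K"
    and "a + J * b = a' + J * b'" "a + K * b = a' + K * b'"
  shows "a = a'" "b = b'"
proof -
  obtain r where r: "r \<noteq> 0" "\<And>y. (J - K) * ((J - K) * y) = r *\<^sub>R y"
    using imag_unit_diff_square assms(1-3) by blast
  have "(a + J * b) - (a + K * b) = (a' + J * b') - (a' + K * b')"
    using assms(4,5) by simp
  then have "(J - K) * (b - b') = 0"
    by (simp add: alg_mult.diff_left alg_mult.diff_right)
  then have "r *\<^sub>R (b - b') = 0"
    using r(2)[of "b - b'"] by (simp add: alg_mult.zero_right)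
  with r(1) show "b = b'" by simp
  with assms(4) show "a = a'" by simp
qed

text \<open>At a real point every unit represents the same point, so \<open>v 1\<close> and
  \<open>- v 1\<close> serve. Elsewhere \<open>J\<close> already lies in \<open>M\<close>, and a
  small rotation of it stays in \<open>\<Omega>\<close> by relative openness.\<close>

lemma two_imag_units:
  assumes "openin (top_of_set M) \<Omega>" "J \<in> imag_units" "slice_point J z \<in> \<Omega>"
  obtains J0 J1 where "J0 \<in> M \<inter> imag_units" "J1 \<in> M \<inter> imag_units" "J0 \<noteq> J1"
    "slice_point J0 z \<in> \<Omega>" "slice_point J1 z \<in> \<Omega>"
proof (cases "Im z = 0")
  case True
  have "1 \<in> {1..m}" using m_ge_2 by auto
  then have J1: "v 1 \<in> M \<inter> imag_units"
    using basis_mem[of 1] basis_imag_unit[of 1] by auto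
  have "v 1 \<noteq> - v 1"
  proof
    assume "v 1 = - v 1"
    then have "2 *\<^sub>R v 1 = 0" unfolding scaleR_2 eq_neg_iff_add_eq_0 .
    then have "v 1 = 0" by simp
    then show False using imag_unitsD(2)[of "v 1"] J1 by (simp add: alg_mult.zero_left)
  qed
  then show ?thesis
    using that[of "v 1" "- v 1"] J1 assms(3) True imag_units_minus[of "v 1"] subspace_M
    by (auto simp: slice_point_def subspace_neg)
next
  case False
  have "slice_point J z \<in> M" using assms(1,3) openin_imp_subset by blast
  then have J: "J \<in> M \<inter> imag_units" using imag_unit_mem False assms(2) by blast
  then obtain K where K: "K \<in> M \<inter> imag_units" "J * K + K * J = 0"
    by (rule orthogonal_imag_unit)
  let ?L = "\<lambda>t. cos t *\<^sub>R J + sin t *\<^sub>R K"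
  have L: "?L t \<in> M \<inter> imag_units" for t
    using J K subspace_M rotated_imag_unit[of J K t] by (auto intro!: subspace_add subspace_scale)
  have "\<exists>N. open N \<and> 0 \<in> N \<and> (\<forall>t\<in>N. slice_point (?L t) z \<in> \<Omega>)"
  proof (rule openin_vimage_neighbourhood[OF assms(1)])
    show "continuous_on UNIV (\<lambda>t. slice_point (?L t) z)"
      unfolding slice_point_def by (intro continuous_intros)
    show "slice_point (?L t) z \<in> M" for t
      using L[of t] by (intro slice_point_mem) blast
    show "slice_point (?L 0) z \<in> \<Omega>" using assms(3) by simp
  qed
  then obtain N where N: "open N" "0 \<in> N" "\<And>t. t \<in> N \<Longrightarrow> slice_point (?L t) z \<in> \<Omega>"
    by blast
  then obtain e where e: "e > 0" "ball 0 e \<subseteq> N"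
    by (meson openE)
  \<comment> \<open>The first bound keeps the rotated point in \<open>\<Omega>\<close>; the second
    keeps \<open>t\<close> below \<open>pi\<close>, so that \<open>sin t\<close> is
    positive.\<close>
  define t where "t = min (e / 2) 1"
  have "t > 0" "t < pi" "t \<in> N"
    using e pi_gt3 by (auto simp: t_def dist_real_def)
  then have "sin t \<noteq> 0" using sin_gt_zero[of t] by simp
  then have "?L t \<noteq> J" using rotated_imag_unit_neq J K by blast
  then show ?thesis
    using that[OF L J] N(3) \<open>t \<in> N\<close> assms(3) by blast
qed

section \<open>The Cauchy-Riemann operator on slices\<close>

lemma dbar_eq:
  assumes "openin (top_of_set M) \<Omega>" "x \<in> \<Omega>" "(f has_derivative f') (at x within \<Omega>)"
  shows "dbar M v f x = (1/2) *\<^sub>R (f' 1 + (\<Sum>i=1..m. v i * f' (v i)))"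
proof -
  have "partial_deriv v i f x = f' (v i)" if "i \<le> m" for i
    using partial_deriv_eq[of M \<Omega> x v i f f'] assms subspace_M basis_mem[OF that] by blast
  then show ?thesis
    unfolding dbar_def by (simp add: basis_zero)
qed

text \<open>Moving \<open>v i\<close> past \<open>x\<close> needs only the linearized left alternative law; the resulting radial
  derivative cancels against \<open>Im x\<close> times the real one by holomorphy on the slice.\<close>

lemma dbar_mult_id:
  assumes "openin (top_of_set M) \<Omega>" "J \<in> M \<inter> imag_units" "slice_point J z \<in> \<Omega>"
    and f': "(f has_derivative f') (at (slice_point J z) within \<Omega>)"
    and hol: "Im z *\<^sub>R f' J = Im z *\<^sub>R (J * f' 1)"
  shows "dbar M v (\<lambda>y. y * f y) (slice_point J z) =
    ((1 - real m) / 2) *\<^sub>R f (slice_point J z) + slice_point J (cnj z) * dbar M v f (slice_point J z)"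
proof -
  define x where "x = slice_point J z"
  define xc where "xc = slice_point J (cnj z)"
  have J: "J \<in> M" "J \<in> imag_units" "conjg J = - J" using assms(2) by (auto simp: imag_unitsD)
  obtain c where c: "J = (\<Sum>i=1..m. c i *\<^sub>R v i)"
    "\<And>i. i \<in> {1..m} \<Longrightarrow> v i * J + J * v i = (- 2 * c i) *\<^sub>R 1"
    using imaginary_expansion[OF J(1,3)] by blast
  have lin: "linear f'" using f' by (rule has_derivative_linear)
  have d: "((\<lambda>y. y * f y) has_derivative (\<lambda>h. x * f' h + h * f x)) (at x within \<Omega>)"
    using alg_mult.FDERIV[OF has_derivative_ident f'] by (simp add: x_def)
  \<comment> \<open>The anticommutator of \<open>v i\<close> and \<open>x\<close> is
    \<open>2 * Re z\<close> times \<open>v i\<close> plus a real number. Since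
    \<open>2 * Re z\<close> minus \<open>x\<close> is the conjugate \<open>xc\<close>, moving
    \<open>v i\<close> past \<open>x\<close> conjugates \<open>x\<close> and costs only a scalar
    term.\<close>
  have swap: "v i * (x * y) = xc * (v i * y) - (2 * Im z * c i) *\<^sub>R y" if "i \<in> {1..m}" for i y
  proof -
    have "v i * (x * y) = (v i * x + x * v i) * y - x * (v i * y)"
      using alternative_left_linearized[of "v i" x y] by (simp add: eq_diff_eq)
    also have "v i * x + x * v i = (2 * Re z) *\<^sub>R v i + Im z *\<^sub>R (v i * J + J * v i)"
      unfolding scaleR_scaleR[symmetric] scaleR_2
      by (simp add: x_def slice_point_def mult_add_left mult_add_right mult_scale_left
          mult_scale_right unit_left unit_right scaleR_add_right)
    also have "\<dots> = (2 * Re z) *\<^sub>R v i - (2 * Im z * c i) *\<^sub>R 1"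
      by (simp add: c(2)[OF that])
    also have "\<dots> * y - x * (v i * y) = ((2 * Re z) *\<^sub>R 1 - x) * (v i * y) - (2 * Im z * c i) *\<^sub>R y"
      by (simp add: alg_mult.diff_left mult_scale_left unit_left)
    also have "(2 * Re z) *\<^sub>R 1 - x = xc"
      by (simp add: x_def xc_def slice_point_def scaleR_2[symmetric] algebra_simps)
    finally show ?thesis .
  qed
  have f'J: "f' J = (\<Sum>i=1..m. c i *\<^sub>R f' (v i))"
    by (subst c(1)) (simp only: linear_sum[OF lin] linear_cmul[OF lin])
  define S where "S = (\<Sum>i=1..m. v i * f' (v i))"
  have sq: "v i * (v i * f x) = - f x" if "i \<in> {1..m}" for i
    using imag_unitsD(3)[OF basis_imag_unit[OF that]] .
  have "(\<Sum>i=1..m. v i * (x * f' (v i) + v i * f x))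
      = (\<Sum>i=1..m. xc * (v i * f' (v i)) - (2 * Im z) *\<^sub>R (c i *\<^sub>R f' (v i)) - f x)"
    by (intro sum.cong refl) (simp add: mult_add_right swap sq)
  also have "\<dots> = xc * S - (2 * Im z) *\<^sub>R f' J - real m *\<^sub>R f x"
    by (simp only: f'J S_def sum_subtractf alg_mult.sum_right scaleR_sum_right sum_constant_scaleR
        card_atLeastAtMost diff_Suc_1 of_nat_diff)
  also have "(2 * Im z) *\<^sub>R f' J = 2 *\<^sub>R ((Im z *\<^sub>R J) * f' 1)"
    unfolding scaleR_scaleR[symmetric] hol mult_scale_left ..
  finally have sum: "(\<Sum>i=1..m. v i * (x * f' (v i) + v i * f x))
      = xc * S - 2 *\<^sub>R ((Im z *\<^sub>R J) * f' 1) - real m *\<^sub>R f x" .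
  \<comment> \<open>Writing \<open>x\<close> through \<open>xc\<close> in the term of the real
    derivative produces the radial term of \<open>sum\<close> with the opposite sign.\<close>
  have "x = xc + 2 *\<^sub>R (Im z *\<^sub>R J)"
    unfolding scaleR_2 by (simp add: x_def xc_def slice_point_def)
  then have x1: "x * f' 1 = xc * f' 1 + 2 *\<^sub>R ((Im z *\<^sub>R J) * f' 1)"
    by (simp add: mult_add_left mult_scale_left)
  have "dbar M v (\<lambda>y. y * f y) x = (1/2) *\<^sub>R ((xc * f' 1 + xc * S) + (1 - real m) *\<^sub>R f x)"
    unfolding dbar_eq[OF assms(1) assms(3)[folded x_def] d] sum x1
    by (simp add: unit_left scaleR_diff_left)
  also have "\<dots> = ((1 - real m) / 2) *\<^sub>R f x + xc * dbar M v f x"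
    unfolding x_def dbar_eq[OF assms(1,3) f'] S_def
    by (simp add: mult_add_right mult_scale_right scaleR_add_right)
  finally show ?thesis by (simp only: x_def xc_def)
qed

text \<open>The derivative is read off along the circle \<open>cos t J + sin t K\<close> in the sphere through the
  point.\<close>

lemma derivative_along_sphere:
  assumes "openin (top_of_set M) \<Omega>" "J \<in> M \<inter> imag_units" "slice_point J z \<in> \<Omega>"
    and f': "(f has_derivative f') (at (slice_point J z) within \<Omega>)"
    and slice: "\<And>L. L \<in> imag_units \<Longrightarrow> slice_point L z \<in> \<Omega> \<Longrightarrow> f (slice_point L z) = a + L * b"
    and w: "w \<in> M" "conjg w = - w" "J * w + w * J = 0"
  shows "Im z *\<^sub>R f' w = w * b"
proof (cases "w = 0")
  case True
  then show ?thesis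
    using linear_0[OF has_derivative_linear[OF f']] by (simp add: alg_mult.zero_left)
next
  case False
  then obtain r K where K: "r \<noteq> 0" "K \<in> M \<inter> imag_units" "w = r *\<^sub>R K"
    using imaginary_normalize[OF w(1,2)] by metis
  then have "r *\<^sub>R (J * K + K * J) = 0"
    using w(3) by (simp add: mult_scale_left mult_scale_right scaleR_add_right)
  with \<open>r \<noteq> 0\<close> have JK: "J * K + K * J = 0" by simp
  have lin: "linear f'" using f' by (rule has_derivative_linear)
  let ?L = "\<lambda>t. cos t *\<^sub>R J + sin t *\<^sub>R K"
  let ?\<gamma> = "\<lambda>t. slice_point (?L t) z"
  have L: "?L t \<in> imag_units" for t
    using rotated_imag_unit assms(2) K(2) JK by blast
  have \<gamma>M: "?\<gamma> t \<in> M" for t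
    using assms(2) K(2) subspace_M by (intro slice_point_mem subspace_add subspace_scale) auto
  have cont: "continuous_on UNIV ?\<gamma>"
    unfolding slice_point_def by (intro continuous_intros)
  have \<gamma>0: "?\<gamma> 0 = slice_point J z" by simp
  have d\<gamma>: "(?\<gamma> has_derivative (\<lambda>h. h *\<^sub>R (Im z *\<^sub>R K))) (at 0)"
    unfolding slice_point_def by (auto intro!: derivative_eq_intros simp: mult.commute)
  have d1: "((\<lambda>t. f (?\<gamma> t)) has_derivative (\<lambda>h. f' (h *\<^sub>R (Im z *\<^sub>R K)))) (at 0)"
    using has_derivative_compose_openin[OF assms(1) \<gamma>M cont d\<gamma>, of f f'] assms(3) f'
    unfolding \<gamma>0 by blast
  obtain N where N: "open N" "0 \<in> N" "\<And>t. t \<in> N \<Longrightarrow> ?\<gamma> t \<in> \<Omega>"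
    using openin_vimage_neighbourhood[OF assms(1) \<gamma>M cont, of 0] assms(3) unfolding \<gamma>0 by blast
  \<comment> \<open>Near \<open>0\<close> the curve stays in \<open>\<Omega>\<close>, where
    \<open>f\<close> is given by the slice formula. Its explicit derivative is compared with the
    chain rule in \<open>d1\<close>.\<close>
  have "((\<lambda>t. a + ?L t * b) has_derivative (\<lambda>h. h *\<^sub>R (K * b))) (at 0)"
    by (auto intro!: derivative_eq_intros alg_mult.FDERIV
        simp: mult_add_left mult_scale_left alg_mult.zero_right)
  then have d2: "((\<lambda>t. f (?\<gamma> t)) has_derivative (\<lambda>h. h *\<^sub>R (K * b))) (at 0)"
    by (rule has_derivative_transform_within_open[OF _ N(1,2)]) (simp add: slice L N(3))
  have "f' (1 *\<^sub>R (Im z *\<^sub>R K)) = 1 *\<^sub>R (K * b)"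
    using has_derivative_unique[OF d1 d2] by meson
  then have "Im z *\<^sub>R f' K = K * b" by (simp add: linear_cmul[OF lin])
  then have "r *\<^sub>R (Im z *\<^sub>R f' K) = r *\<^sub>R (K * b)" by simp
  then show ?thesis
    by (simp add: K(3) linear_cmul[OF lin] mult_scale_left mult.commute)
qed

text \<open>Each \<open>v i\<close> splits into \<open>c i\<close> times \<open>J\<close> and a part
  orthogonal to \<open>J\<close>: holomorphy handles the first,
  \<open>derivative_along_sphere\<close> the second. Multiplying by \<open>v i\<close> turns each
  \<open>v i * b\<close> into \<open>- b\<close>, giving \<open>m\<close> copies, while the radial
  terms sum to \<open>J * y\<close>, which contributes one \<open>b\<close> and cancels the real
  derivative.\<close>

lemma dbar_slice:
  assumes "openin (top_of_set M) \<Omega>" "J \<in> M \<inter> imag_units" "slice_point J z \<in> \<Omega>" "Im z \<noteq> 0"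
    and f': "(f has_derivative f') (at (slice_point J z) within \<Omega>)"
    and slice: "\<And>L. L \<in> imag_units \<Longrightarrow> slice_point L z \<in> \<Omega> \<Longrightarrow> f (slice_point L z) = a + L * b"
    and hol: "f' J = J * f' 1"
  shows "dbar M v f (slice_point J z) = ((1 - real m) / 2 / Im z) *\<^sub>R b"
proof -
  have J: "J \<in> M" "J \<in> imag_units" "conjg J = - J" "J * J = - 1"
    using assms(2) by (auto simp: imag_unitsD)
  obtain c where c: "J = (\<Sum>i=1..m. c i *\<^sub>R v i)"
    "\<And>i. i \<in> {1..m} \<Longrightarrow> v i * J + J * v i = (- 2 * c i) *\<^sub>R 1"
    using imaginary_expansion[OF J(1,3)] by blast
  have lin: "linear f'" using f' by (rule has_derivative_linear)
  \<comment> \<open>By \<open>hol\<close> this is the amount by which the tangential rule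
    \<open>Im z *\<^sub>R f' w = w * b\<close> fails in the radial direction
    \<open>w = J\<close>.\<close>
  define y where "y = Im z *\<^sub>R (J * f' 1) - J * b"
  have *: "Im z *\<^sub>R (v i * f' (v i)) = (c i *\<^sub>R v i) * y - b"
    if i: "i \<in> {1..m}" for i
  proof -
    define w where "w = v i - c i *\<^sub>R J"
    have "J * w + w * J = (v i * J + J * v i) - c i *\<^sub>R (J * J + J * J)"
      by (simp add: w_def alg_mult.diff_left alg_mult.diff_right mult_scale_left mult_scale_right
          scaleR_add_right)
    also have "\<dots> = 0"
      unfolding c(2)[OF i] J(4) by (simp add: scaleR_2[symmetric] flip: scaleR_minus_right)
    finally have "J * w + w * J = 0" .
    moreover have "w \<in> M" "conjg w = - w"
      using J subspace_M basis_mem[of i] i conjg_basis[OF i] conjg_add[of "v i" "- (c i *\<^sub>R J)"]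
      by (auto simp: w_def subspace_diff subspace_scale conjg_minus conjg_scale)
    ultimately have "Im z *\<^sub>R f' w = w * b"
      using derivative_along_sphere[OF assms(1-3) f' slice] by blast
    moreover have "f' (c i *\<^sub>R J + w) = c i *\<^sub>R (J * f' 1) + f' w"
      by (simp only: linear_add[OF lin] linear_cmul[OF lin] hol)
    then have "f' (v i) = c i *\<^sub>R (J * f' 1) + f' w"
      by (simp add: w_def)
    ultimately have "Im z *\<^sub>R f' (v i) = c i *\<^sub>R (Im z *\<^sub>R (J * f' 1)) + w * b"
      by (simp only: scaleR_add_right scaleR_left_commute[of "c i"])
    also have "\<dots> = c i *\<^sub>R y + v i * b"
      by (simp add: w_def y_def alg_mult.diff_left mult_scale_left scaleR_diff_right)
    finally have "v i * (Im z *\<^sub>R f' (v i)) = v i * (c i *\<^sub>R y) + v i * (v i * b)"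
      by (simp only: mult_add_right)
    then show ?thesis
      unfolding imag_unitsD(3)[OF basis_imag_unit[OF i]] mult_scale_right mult_scale_left by simp
  qed
  have "Im z *\<^sub>R (\<Sum>i=1..m. v i * f' (v i)) = (\<Sum>i=1..m. (c i *\<^sub>R v i) * y - b)"
    unfolding scaleR_sum_right by (intro sum.cong refl) (rule *)
  also have "\<dots> = J * y - real m *\<^sub>R b"
    by (subst c(1)) (simp only: sum_subtractf alg_mult.sum_left sum_constant_scaleR
      card_atLeastAtMost diff_Suc_1)
  also have "\<dots> = - (Im z *\<^sub>R f' 1) + (1 - real m) *\<^sub>R b"
    unfolding y_def alg_mult.diff_right mult_scale_right imag_unitsD(3)[OF J(2)]
    by (simp add: scaleR_diff_left)
  finally have "Im z *\<^sub>R (f' 1 + (\<Sum>i=1..m. v i * f' (v i))) = (1 - real m) *\<^sub>R b"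
    by (simp add: scaleR_add_right)
  then have "inverse (Im z) *\<^sub>R (Im z *\<^sub>R (f' 1 + (\<Sum>i=1..m. v i * f' (v i)))) =
      inverse (Im z) *\<^sub>R ((1 - real m) *\<^sub>R b)"
    by (simp only:)
  then have "f' 1 + (\<Sum>i=1..m. v i * f' (v i)) = ((1 - real m) / Im z) *\<^sub>R b"
    using assms(4) by (simp only: scaleR_scaleR left_inverse scaleR_one divide_inverse
      mult.commute[of "1 - real m"] not_False_eq_True)
  then show ?thesis
    unfolding dbar_eq[OF assms(1,3) f'] by simp
qed

section \<open>Holomorphy on slices and stem functions\<close>

lemma slice_holomorphic_derivative:
  assumes "openin (top_of_set M) \<Omega>" "J \<in> M \<inter> imag_units" "slice_point J z \<in> \<Omega>"
    and "holomorphic_wrt (slice_plane J) ((*) J) ((*) J) f (\<Omega> \<inter> slice_plane J)"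
  shows "\<exists>L. ((\<lambda>w. f (slice_point J w)) has_derivative L) (at z) \<and> (\<forall>h. L (\<i> * h) = J * L h)"
proof -
  have mem: "slice_point J h \<in> slice_plane J" for h by (simp add: slice_plane_eq)
  with assms(3,4) obtain f'
    where f': "(f has_derivative f') (at (slice_point J z) within \<Omega> \<inter> slice_plane J)"
      and lin: "\<forall>h\<in>slice_plane J. f' (J * h) = J * f' h"
    unfolding holomorphic_wrt_def by blast
  obtain T where "open T" "\<Omega> = M \<inter> T" using assms(1) unfolding openin_open by blast
  moreover have "slice_plane J \<subseteq> M" using assms(2) slice_plane_subset by blast
  \<comment> \<open>Relative openness in the plane is what turns the derivative within the slice
    into a full derivative in the complex variable.\<close>
  ultimately have "openin (top_of_set (slice_plane J)) (\<Omega> \<inter> slice_plane J)"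
    unfolding openin_open by blast
  then have "((\<lambda>w. f (slice_point J w)) has_derivative (\<lambda>h. f' (slice_point J h))) (at z)"
    using assms(3) mem f' by (intro has_derivative_slice_point) auto
  moreover have "f' (slice_point J (\<i> * h)) = J * f' (slice_point J h)" for h
    using assms(2) lin mem by (simp add: slice_point_mult_i)
  ultimately show ?thesis by blast
qed

text \<open>Links the derivative of \<open>f\<close> along a slice with the derivative on all of
  \<open>\<Omega>\<close>. Complex linearity of \<open>L\<close> at \<open>1\<close> then becomes
  the relation \<open>f' J = J * f' 1\<close> between directional derivatives.\<close>

lemma derivative_imag_unit:
  assumes "openin (top_of_set M) \<Omega>" "J \<in> M \<inter> imag_units" "slice_point J z \<in> \<Omega>"
    and "(f has_derivative f') (at (slice_point J z) within \<Omega>)"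
    and "((\<lambda>w. f (slice_point J w)) has_derivative L) (at z)"
  shows "L = (\<lambda>h. f' (slice_point J h))"
  using has_derivative_unique[OF assms(5) has_derivative_slice_point[OF assms(1) _ assms(3,4)]]
    assms(2) slice_plane_subset by blast

text \<open>The values of \<open>f\<close> on the slices of \<open>J\<close> and \<open>K\<close>
  form a linear system for the two components of \<open>F\<close>. Solving it uses only
  multiplication by constants, so differentiability carries over from the slices to
  \<open>F\<close>.\<close>

lemma stem_has_derivative:
  assumes "openin (top_of_set M) \<Omega>" "open D" "z \<in> D"
    and J: "J \<in> M \<inter> imag_units" "slice_point J z \<in> \<Omega>"
    and K: "K \<in> M \<inter> imag_units" "slice_point K z \<in> \<Omega>"
    and "J \<noteq> K"
    and F: "\<And>w L. w \<in> D \<Longrightarrow> L \<in> M \<inter> imag_units \<Longrightarrow> slice_point L w \<in> \<Omega> \<Longrightarrow>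
      f (slice_point L w) = fst (F w) + L * snd (F w)"
    and LJ: "((\<lambda>w. f (slice_point J w)) has_derivative LJ) (at z)" "\<And>h. LJ (\<i> * h) = J * LJ h"
    and LK: "((\<lambda>w. f (slice_point K w)) has_derivative LK) (at z)" "\<And>h. LK (\<i> * h) = K * LK h"
  shows "\<exists>F'. (F has_derivative F') (at z) \<and> (\<forall>h. F' (\<i> * h) = cplx_i (F' h))"
proof -
  obtain r where r: "r \<noteq> 0" "\<And>y. (J - K) * ((J - K) * y) = r *\<^sub>R y"
    using imag_unit_diff_square J(1) K(1) \<open>J \<noteq> K\<close> by blast
  have cont: "continuous_on UNIV (slice_point L)" for L :: 'a
    by (rule linear_continuous_on[OF bounded_linear_slice_point])
  have near: "\<exists>N. open N \<and> z \<in> N \<and> (\<forall>w\<in>N. slice_point L w \<in> \<Omega>)"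
    if "L \<in> M" "slice_point L z \<in> \<Omega>" for L
    using openin_vimage_neighbourhood[OF assms(1) slice_point_mem[OF that(1)] cont that(2)] .
  obtain N1 where N1: "open N1" "z \<in> N1" "\<forall>w\<in>N1. slice_point J w \<in> \<Omega>"
    using near[of J] J by auto
  obtain N2 where N2: "open N2" "z \<in> N2" "\<forall>w\<in>N2. slice_point K w \<in> \<Omega>"
    using near[of K] K by auto
  define N where "N = D \<inter> N1 \<inter> N2"
  have N: "open N" "z \<in> N"
    using N1 N2 assms(2,3) by (auto simp: N_def)
  \<comment> \<open>By the choice of \<open>r\<close>, \<open>inverse r\<close> times left
    multiplication by \<open>J - K\<close> inverts left multiplication by
    \<open>J - K\<close>.\<close>
  define G2 where "G2 w = inverse r *\<^sub>R ((J - K) * (f (slice_point J w) - f (slice_point K w)))" for w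
  define G1 where "G1 w = f (slice_point J w) - J * G2 w" for w
  define G2' where "G2' h = inverse r *\<^sub>R ((J - K) * (LJ h - LK h))" for h
  define G1' where "G1' h = LJ h - J * G2' h" for h
  have fJ: "f (slice_point J w) = fst (F w) + J * snd (F w)"
    and fK: "f (slice_point K w) = fst (F w) + K * snd (F w)" if "w \<in> N" for w
    using that N1(3) N2(3) F[OF _ J(1), of w] F[OF _ K(1), of w] by (simp_all only: N_def Int_iff)
  have G2: "G2 w = snd (F w)" if "w \<in> N" for w
  proof -
    have "f (slice_point J w) - f (slice_point K w) = (J - K) * snd (F w)"
      unfolding fJ[OF that] fK[OF that] alg_mult.diff_left by simp
    then show ?thesis
      unfolding G2_def using r(1) by (simp only: r(2) scaleR_scaleR left_inverse scaleR_one not_False_eq_True)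
  qed
  have G1: "G1 w = fst (F w)" if "w \<in> N" for w
    unfolding G1_def G2[OF that] fJ[OF that] by simp
  have dG2: "(G2 has_derivative G2') (at z)"
    unfolding G2_def[abs_def] G2'_def[abs_def]
    by (intro has_derivative_scaleR_right bounded_linear.has_derivative[OF alg_mult.bounded_linear_right]
        has_derivative_diff LJ(1) LK(1))
  have dG1: "(G1 has_derivative G1') (at z)"
    unfolding G1_def[abs_def] G1'_def[abs_def]
    by (intro bounded_linear.has_derivative[OF alg_mult.bounded_linear_right] has_derivative_diff LJ(1) dG2)
  have "((\<lambda>w. (G1 w, G2 w)) has_derivative (\<lambda>h. (G1' h, G2' h))) (at z)"
    using dG1 dG2 by (rule has_derivative_Pair)
  then have "(F has_derivative (\<lambda>h. (G1' h, G2' h))) (at z)"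
    by (rule has_derivative_transform_within_open[OF _ N]) (simp add: G1 G2)
  moreover have "G1' (\<i> * h) = - G2' h \<and> G2' (\<i> * h) = G1' h" for h
  proof -
    have J': "LJ h = G1' h + J * G2' h" for h
      by (simp add: G1'_def)
    have "(J - K) * G2' h = LJ h - LK h" for h
      unfolding G2'_def mult_scale_right r(2) using r(1) by simp
    then have "LK h = LJ h - (J - K) * G2' h" for h
      by simp
    then have K': "LK h = G1' h + K * G2' h" for h
      by (simp add: J' alg_mult.diff_left)
    have JK: "J \<in> imag_units" "K \<in> imag_units" using J K by auto
    \<comment> \<open>Complex linearity on each of the two slices gives one equation; two different
      units separate the components and yield the Cauchy-Riemann equations for
      \<open>F\<close>.\<close>
    have "G1' (\<i> * h) + J * G2' (\<i> * h) = - G2' h + J * G1' h"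
      using LJ(2)[of h] unfolding J' mult_add_right imag_unitsD(3)[OF JK(1)] by simp
    moreover have "G1' (\<i> * h) + K * G2' (\<i> * h) = - G2' h + K * G1' h"
      using LK(2)[of h] unfolding K' mult_add_right imag_unitsD(3)[OF JK(2)] by simp
    ultimately show ?thesis
      using stem_values_unique[OF J(1) K(1) \<open>J \<noteq> K\<close>] by blast
  qed
  ultimately show ?thesis
    by (intro exI[of _ "\<lambda>h. (G1' h, G2' h)"]) (simp add: cplx_i_def)
qed

text \<open>The quadratic cone only supplies a unit of the whole algebra. It lies in
  \<open>M\<close> unless the point is real, and then \<open>v 1\<close> can replace it.\<close>

lemma mem_slice:
  assumes "x \<in> M"
  obtains J z where "J \<in> M \<inter> imag_units" "x = slice_point J z"
proof -
  have "x \<in> quadratic_cone"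
    using hypercomplex assms by (auto simp: hypercomplex_subspace_def)
  then obtain K z where K: "K \<in> imag_units" and x: "x = slice_point K z"
    unfolding quadratic_cone_def slice_plane_eq by blast
  have "1 \<in> {1..m}" using m_ge_2 by auto
  then have v1: "v 1 \<in> M \<inter> imag_units"
    using basis_mem[of 1] basis_imag_unit[of 1] by auto
  show ?thesis
  proof (cases "Im z = 0")
    case True
    then have "x = slice_point (v 1) z" by (simp add: x slice_point_def)
    with v1 show ?thesis by (rule that)
  next
    case False
    then have "K \<in> M" using imag_unit_mem[of K z] assms x by simp
    with K x show ?thesis using that by blast
  qed
qed

section \<open>The two directions\<close>

lemma strongly_slice_regular_extends:
  assumes \<Omega>: "openin (top_of_set M) \<Omega>" and f: "strongly_slice_regular M v \<Omega> f"
  shows "\<exists>g. slice_regular_on g (symmetric_completion \<Omega>) \<and> (\<forall>x\<in>\<Omega>. g x = f x)"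
proof -
  define D where "D = {z. \<exists>J\<in>imag_units. slice_point J z \<in> \<Omega>}"
  \<comment> \<open>The chosen unit is immaterial: zonality makes \<open>a\<close> and
    \<open>b\<close> functions of the coordinate \<open>z\<close> alone.\<close>
  define a where "a z = dbar M v f (slice_point (SOME J. J \<in> imag_units \<and> slice_point J z \<in> \<Omega>) z)"
    for z
  define b where "b z = dbar M v (\<lambda>x. x * f x)
      (slice_point (SOME J. J \<in> imag_units \<and> slice_point J z \<in> \<Omega>) z)" for z
  \<comment> \<open>Inverse of the factor of \<open>f\<close> in \<open>dbar_mult_id\<close>, which
    is nonzero as \<open>m \<ge> 2\<close>. Solving that identity gives \<open>f\<close> as
    \<open>\<kappa>\<close> times \<open>b\<close> minus conjugated \<open>x\<close> times
    \<open>a\<close>; the parts without and with the unit form \<open>F\<close>.\<close>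
  define \<kappa> where "\<kappa> = 2 / (1 - real m)"
  define F where "F z = (\<kappa> *\<^sub>R (b z - Re z *\<^sub>R a z), (\<kappa> * Im z) *\<^sub>R a z)" for z
  have \<kappa>: "\<kappa> * ((1 - real m) / 2) = 1"
    using m_ge_2 by (simp add: \<kappa>_def)
  have zon: "zonal_on \<Omega> (dbar M v f)" "zonal_on \<Omega> (dbar M v (\<lambda>x. x * f x))"
    using f unfolding strongly_slice_regular_def by blast+
  have ab: "a z = dbar M v f (slice_point J z)" "b z = dbar M v (\<lambda>x. x * f x) (slice_point J z)"
    if "J \<in> imag_units" "slice_point J z \<in> \<Omega>" for J z
  proof -
    let ?K = "SOME J. J \<in> imag_units \<and> slice_point J z \<in> \<Omega>"
    have "?K \<in> imag_units \<and> slice_point ?K z \<in> \<Omega>"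
      using someI[of "\<lambda>J. J \<in> imag_units \<and> slice_point J z \<in> \<Omega>" J] that by simp
    then show "a z = dbar M v f (slice_point J z)" "b z = dbar M v (\<lambda>x. x * f x) (slice_point J z)"
      unfolding a_def b_def
      using zonal_onD[OF zon(1) _ that(1) _ that(2)] zonal_onD[OF zon(2) _ that(1) _ that(2)] by simp_all
  qed
  obtain f' where f': "\<And>x. x \<in> \<Omega> \<Longrightarrow> (f has_derivative f' x) (at x within \<Omega>)"
    using f unfolding strongly_slice_regular_def C1_on_def by blast
  have hol: "\<exists>L. ((\<lambda>w. f (slice_point J w)) has_derivative L) (at z) \<and> (\<forall>h. L (\<i> * h) = J * L h)"
    if J: "J \<in> M \<inter> imag_units" "slice_point J z \<in> \<Omega>" for J z
  proof -
    have "slice_point J z \<in> \<Omega> \<inter> slice_plane J" using J(2) by (simp add: slice_plane_eq)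
    then have "holomorphic_wrt (slice_plane J) ((*) J) ((*) J) f (\<Omega> \<inter> slice_plane J)"
      using f J(1) unfolding strongly_slice_regular_def by blast
    then show ?thesis by (rule slice_holomorphic_derivative[OF \<Omega> J])
  qed
  have val: "f (slice_point J z) = fst (F z) + J * snd (F z)"
    if J: "J \<in> M \<inter> imag_units" "slice_point J z \<in> \<Omega>" for J z
  proof -
    let ?x = "slice_point J z"
    obtain L where L: "((\<lambda>w. f (slice_point J w)) has_derivative L) (at z)" "\<And>h. L (\<i> * h) = J * L h"
      using hol[OF J] by blast
    have "L = (\<lambda>h. f' ?x (slice_point J h))"
      by (rule derivative_imag_unit[OF \<Omega> J f'[OF J(2)] L(1)])
    with L(2)[of 1] have "f' ?x J = J * f' ?x 1"
      by (simp add: slice_point_def)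
    then have "b z = ((1 - real m) / 2) *\<^sub>R f ?x + slice_point J (cnj z) * a z"
      using dbar_mult_id[OF \<Omega> J f'[OF J(2)]] ab[of J z] J by simp
    then have "\<kappa> *\<^sub>R (b z - slice_point J (cnj z) * a z) = (\<kappa> * ((1 - real m) / 2)) *\<^sub>R f ?x"
      by simp
    then have "f ?x = \<kappa> *\<^sub>R (b z - slice_point J (cnj z) * a z)"
      unfolding \<kappa> by simp
    then show ?thesis
      by (simp add: F_def slice_point_def alg_mult.diff_left mult_scale_left mult_scale_right unit_left
          scaleR_diff_right)
  qed
  \<comment> \<open>The unit witnessing \<open>z \<in> D\<close> may lie outside \<open>M\<close> at
    real points, where its slice need not stay in \<open>M\<close>; it is first exchanged for a unit
    of \<open>M\<close>.\<close>
  have "open D"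
  proof (subst open_subopen, rule ballI)
    fix z assume "z \<in> D"
    then obtain J where J: "J \<in> imag_units" "slice_point J z \<in> \<Omega>" by (auto simp: D_def)
    obtain J0 where J0: "J0 \<in> M" "J0 \<in> imag_units" "slice_point J0 z \<in> \<Omega>"
      using two_imag_units[OF \<Omega> J] by blast
    obtain N where "open N" "z \<in> N" "\<forall>w\<in>N. slice_point J0 w \<in> \<Omega>"
      using openin_vimage_neighbourhood[OF \<Omega> slice_point_mem[OF J0(1)]
          linear_continuous_on[OF bounded_linear_slice_point] J0(3)] by blast
    then show "\<exists>T. open T \<and> z \<in> T \<and> T \<subseteq> D"
      using J0(2) unfolding D_def by blast
  qed
  have cnjD: "cnj z \<in> D" if z: "z \<in> D" for z
  proof -
    obtain J where J: "J \<in> imag_units" "slice_point J z \<in> \<Omega>" using z by (auto simp: D_def)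
    then have "slice_point (- J) (cnj z) \<in> \<Omega>" by (simp add: slice_point_minus)
    then show ?thesis using imag_units_minus[OF J(1)] unfolding D_def by blast
  qed
  have "cnj ` D = D"
  proof
    show "D \<subseteq> cnj ` D"
    proof
      fix z assume "z \<in> D"
      then show "z \<in> cnj ` D" using cnjD[of z] by (intro image_eqI[of _ _ "cnj z"]) simp_all
    qed
  qed (use cnjD in blast)
  have stem: "stem_function D F"
    unfolding stem_function_def
  proof
    fix z assume "z \<in> D"
    then obtain J where J: "J \<in> imag_units" "slice_point J z \<in> \<Omega>" by (auto simp: D_def)
    have J': "- J \<in> imag_units" "slice_point (- J) (cnj z) \<in> \<Omega>"
      using J by (simp_all add: imag_units_minus slice_point_minus)
    \<comment> \<open>The coordinate \<open>cnj z\<close> with unit \<open>- J\<close> names the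
      same point, so \<open>a\<close> and \<open>b\<close> are even; the factor \<open>Im z\<close>
      makes the second component of \<open>F\<close> odd.\<close>
    have "a (cnj z) = a z" "b (cnj z) = b z"
      using ab[OF J] ab[OF J'] by (simp_all add: slice_point_minus)
    then show "F (cnj z) = cplx_conj (F z)"
      by (simp add: F_def cplx_conj_def)
  qed
  have "holomorphic_wrt UNIV ((*) \<i>) cplx_i F D"
    unfolding holomorphic_wrt_def
  proof
    fix z assume "z \<in> D"
    then obtain J where J: "J \<in> imag_units" "slice_point J z \<in> \<Omega>" by (auto simp: D_def)
    obtain J0 J1 where J01: "J0 \<in> M \<inter> imag_units" "J1 \<in> M \<inter> imag_units" "J0 \<noteq> J1"
      "slice_point J0 z \<in> \<Omega>" "slice_point J1 z \<in> \<Omega>"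
      by (rule two_imag_units[OF \<Omega> J])
    obtain L0 where L0: "((\<lambda>w. f (slice_point J0 w)) has_derivative L0) (at z)"
      "\<And>h. L0 (\<i> * h) = J0 * L0 h" using hol[OF J01(1,4)] by blast
    obtain L1 where L1: "((\<lambda>w. f (slice_point J1 w)) has_derivative L1) (at z)"
      "\<And>h. L1 (\<i> * h) = J1 * L1 h" using hol[OF J01(2,5)] by blast
    obtain F' where F': "(F has_derivative F') (at z)" "\<forall>h. F' (\<i> * h) = cplx_i (F' h)"
      using stem_has_derivative[OF \<Omega> \<open>open D\<close> \<open>z \<in> D\<close> J01(1,4,2,5,3) val L0 L1] by blast
    then show "\<exists>f'. (F has_derivative f') (at z within D) \<and> (\<forall>h\<in>UNIV. f' (\<i> * h) = cplx_i (f' h))"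
      using has_derivative_at_withinI by blast
  qed
  moreover obtain g where g: "\<And>z J. z \<in> D \<Longrightarrow> J \<in> imag_units \<Longrightarrow>
      g (slice_point J z) = fst (F z) + J * snd (F z)"
    using stem_function_induces[OF stem] by blast
  moreover have "g x = f x" if x: "x \<in> \<Omega>" for x
  proof -
    have "x \<in> M" using x \<Omega> openin_imp_subset by blast
    then obtain J z where J: "J \<in> M \<inter> imag_units" "x = slice_point J z" by (rule mem_slice)
    then have "z \<in> D" using x unfolding D_def by blast
    then show ?thesis using g[of z J] val[of J z] J x by simp
  qed
  moreover have "symmetric_completion \<Omega> = circularization D"
    unfolding D_def by (rule symmetric_completion_eq_circularization)
  ultimately show ?thesis
    using \<open>open D\<close> \<open>cnj ` D = D\<close> stem unfolding slice_regular_on_def by blast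
qed

text \<open>The domain of the stem function is hidden in \<open>slice_regular_on\<close>. Its
  invariance under conjugation ensures that it contains every coordinate of every point of
  \<open>\<Omega>\<close>.\<close>

lemma slice_regular_on_completionE:
  assumes "slice_regular_on g (symmetric_completion \<Omega>)"
  obtains D F where "open D" "holomorphic_wrt UNIV ((*) \<i>) cplx_i F D"
    "\<And>J z. J \<in> imag_units \<Longrightarrow> slice_point J z \<in> \<Omega> \<Longrightarrow> z \<in> D"
    "\<And>J z. J \<in> imag_units \<Longrightarrow> z \<in> D \<Longrightarrow> g (slice_point J z) = fst (F z) + J * snd (F z)"
proof -
  obtain D F where D: "open D" "cnj ` D = D" "symmetric_completion \<Omega> = circularization D"
    and F: "holomorphic_wrt UNIV ((*) \<i>) cplx_i F D"
      "\<forall>z\<in>D. \<forall>J\<in>imag_units. g (slice_point J z) = fst (F z) + J * snd (F z)"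
    using assms unfolding slice_regular_on_def by blast
  have "z \<in> D" if J: "J \<in> imag_units" "slice_point J z \<in> \<Omega>" for J z
  proof (rule slice_point_mem_circularization[OF D(2) J(1)])
    have "slice_point J z \<in> symmetric_completion \<Omega>"
      unfolding symmetric_completion_eq_circularization circularization_def using J by blast
    then show "slice_point J z \<in> circularization D" unfolding D(3) .
  qed
  with D(1) F show ?thesis using that by blast
qed

lemma extends_strongly_slice_regular:
  assumes \<Omega>: "openin (top_of_set M) \<Omega>" and f: "C1_on M f \<Omega>"
    and g: "slice_regular_on g (symmetric_completion \<Omega>)" "\<forall>x\<in>\<Omega>. g x = f x"
  shows "strongly_slice_regular M v \<Omega> f"
proof -
  obtain D F where D: "open D" "\<And>J z. J \<in> imag_units \<Longrightarrow> slice_point J z \<in> \<Omega> \<Longrightarrow> z \<in> D"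
    and F: "holomorphic_wrt UNIV ((*) \<i>) cplx_i F D"
    and gF: "\<And>J z. J \<in> imag_units \<Longrightarrow> z \<in> D \<Longrightarrow> g (slice_point J z) = fst (F z) + J * snd (F z)"
    by (rule slice_regular_on_completionE[OF g(1)]) blast
  have val: "f (slice_point J z) = fst (F z) + J * snd (F z)"
    if "J \<in> imag_units" "slice_point J z \<in> \<Omega>" for J z
    using gF[OF that(1) D(2)[OF that]] g(2) that(2) by simp
  obtain f' where f': "\<And>x. x \<in> \<Omega> \<Longrightarrow> (f has_derivative f' x) (at x within \<Omega>)"
    using f unfolding C1_on_def by blast
  have hol: "f' (slice_point J z) (slice_point J (\<i> * h)) = J * f' (slice_point J z) (slice_point J h)"
    if J: "J \<in> M \<inter> imag_units" "slice_point J z \<in> \<Omega>" for J z h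
  proof -
    have J': "J \<in> M" "J \<in> imag_units" using J by auto
    have "z \<in> D" using D(2) J'(2) J(2) .
    then obtain F' where "(F has_derivative F') (at z within D)" and F'i: "\<And>h. F' (\<i> * h) = cplx_i (F' h)"
      using F unfolding holomorphic_wrt_def by blast
    then have F': "(F has_derivative F') (at z)"
      unfolding at_within_open[OF \<open>z \<in> D\<close> D(1)] by simp
    obtain N where N: "open N" "z \<in> N" "\<forall>w\<in>N. slice_point J w \<in> \<Omega>"
      using openin_vimage_neighbourhood[OF \<Omega> slice_point_mem[OF J'(1)]
          linear_continuous_on[OF bounded_linear_slice_point] J(2)] by blast
    \<comment> \<open>Differentiating the slice formula on one slice and using uniqueness of
      derivatives expresses \<open>f'\<close> there through \<open>F'\<close>, so it inherits
      complex linearity.\<close>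
    have "((\<lambda>w. fst (F w) + J * snd (F w)) has_derivative (\<lambda>h. fst (F' h) + J * snd (F' h))) (at z)"
      by (intro has_derivative_add has_derivative_fst has_derivative_snd F'
          bounded_linear.has_derivative[OF alg_mult.bounded_linear_right])
    then have "((\<lambda>w. f (slice_point J w)) has_derivative (\<lambda>h. fst (F' h) + J * snd (F' h))) (at z)"
      by (rule has_derivative_transform_within_open[OF _ N(1,2)]) (use N(3) val J'(2) in simp)
    from derivative_imag_unit[OF \<Omega> J f'[OF J(2)] this]
    have eq: "f' (slice_point J z) (slice_point J h) = fst (F' h) + J * snd (F' h)" for h
      by (rule fun_cong[symmetric])
    show ?thesis
      unfolding eq F'i cplx_i_def mult_add_right imag_unitsD(3)[OF J'(2)] by simp
  qed
  have hol_unit: "f' (slice_point J z) J = J * f' (slice_point J z) 1"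
    if J: "J \<in> M \<inter> imag_units" "slice_point J z \<in> \<Omega>" for J z
    using hol[OF J, of 1] by (simp add: slice_point_def)
  have in_M: "K \<in> M \<inter> imag_units"
    if "K \<in> imag_units" "slice_point K z \<in> \<Omega>" "Im z \<noteq> 0" for K z
    using that \<Omega> openin_imp_subset imag_unit_mem by blast
  have dbar_f: "dbar M v f (slice_point K z) = ((1 - real m) / 2 / Im z) *\<^sub>R snd (F z)"
    if K: "K \<in> imag_units" "slice_point K z \<in> \<Omega>" "Im z \<noteq> 0" for K z
    using dbar_slice[OF \<Omega> in_M[OF K] K(2,3) f'[OF K(2)] val hol_unit[OF in_M[OF K] K(2)]] .
  have dbar_xf: "dbar M v (\<lambda>x. x * f x) (slice_point K z) =
      ((1 - real m) / 2) *\<^sub>R (fst (F z) + (Re z / Im z) *\<^sub>R snd (F z))"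
    if K: "K \<in> imag_units" "slice_point K z \<in> \<Omega>" "Im z \<noteq> 0" for K z
  proof -
    define c where "c = (1 - real m) / 2"
    have "dbar M v (\<lambda>x. x * f x) (slice_point K z) =
        c *\<^sub>R (fst (F z) + K * snd (F z)) + slice_point K (cnj z) * ((c / Im z) *\<^sub>R snd (F z))"
      using dbar_mult_id[OF \<Omega> in_M[OF K] K(2) f'[OF K(2)]] hol_unit[OF in_M[OF K] K(2)]
      unfolding dbar_f[OF K] val[OF K(1,2)] c_def by simp
    \<comment> \<open>The imaginary part of the conjugated point cancels the term
      \<open>K * snd (F z)\<close>, so the result no longer depends on \<open>K\<close>.\<close>
    also have "\<dots> = c *\<^sub>R (fst (F z) + (Re z / Im z) *\<^sub>R snd (F z))"
      using K(3) by (simp add: slice_point_def alg_mult.diff_left mult_scale_left mult_scale_right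
          unit_left scaleR_diff_right scaleR_add_right)
    finally show ?thesis by (simp only: c_def)
  qed
  have zonal: "zonal_on \<Omega> u"
    if u: "\<And>K z. K \<in> imag_units \<Longrightarrow> slice_point K z \<in> \<Omega> \<Longrightarrow> Im z \<noteq> 0 \<Longrightarrow> u (slice_point K z) = U z"
    for u :: "'a \<Rightarrow> 'a" and U
    unfolding zonal_on_def
  proof
    fix y assume "y \<in> \<Omega>"
    then have "y \<in> M" using \<Omega> openin_imp_subset by blast
    then obtain J z where J: "J \<in> M \<inter> imag_units" "y = slice_point J z" by (rule mem_slice)
    \<comment> \<open>The sphere of a real point is that point alone, so its constant is simply the
      value there; the formula \<open>U\<close> is needed only at nonreal points.\<close>
    have "u x = (if Im z = 0 then u (Re z *\<^sub>R 1) else U z)" if x: "x \<in> sphere_of y \<inter> \<Omega>" for x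
    proof -
      obtain K where "K \<in> imag_units" "x = slice_point K z"
        by (rule sphere_ofE[of x J z]) (use x J in auto)
      then show ?thesis
        using u[of K z] x by (auto simp: slice_point_def)
    qed
    then show "u constant_on sphere_of y \<inter> \<Omega>"
      unfolding constant_on_def by blast
  qed
  have "holomorphic_wrt (slice_plane I) ((*) I) ((*) I) f (\<Omega> \<inter> slice_plane I)"
    if I: "I \<in> M \<inter> imag_units" for I
    unfolding holomorphic_wrt_def
  proof
    fix x assume x: "x \<in> \<Omega> \<inter> slice_plane I"
    then obtain z where z: "x = slice_point I z" unfolding slice_plane_eq by blast
    have x\<Omega>: "slice_point I z \<in> \<Omega>" using x unfolding z by blast
    have "(f has_derivative f' x) (at x within \<Omega> \<inter> slice_plane I)"
      by (rule has_derivative_subset[OF f']) (use x in auto)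
    moreover have "\<forall>h\<in>slice_plane I. f' x (I * h) = I * f' x h"
    proof
      fix h assume "h \<in> slice_plane I"
      then obtain w where h: "h = slice_point I w" unfolding slice_plane_eq by blast
      have "I * h = slice_point I (\<i> * w)" unfolding h using I by (simp add: slice_point_mult_i)
      then show "f' x (I * h) = I * f' x h"
        using hol[OF I x\<Omega>, of w] by (simp only: z h)
    qed
    ultimately show "\<exists>f'. (f has_derivative f') (at x within \<Omega> \<inter> slice_plane I) \<and>
        (\<forall>h\<in>slice_plane I. f' (I * h) = I * f' h)" by blast
  qed
  moreover have "zonal_on \<Omega> (dbar M v f)" "zonal_on \<Omega> (dbar M v (\<lambda>x. x * f x))"
    by (rule zonal, rule dbar_f, assumption+) (rule zonal, rule dbar_xf, assumption+)
  ultimately show ?thesis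
    using f unfolding strongly_slice_regular_def by blast
qed

text \<open>Uniqueness is decided sphere by sphere. Every sphere of the completion contains points
  of \<open>\<Omega>\<close> represented by two different units of \<open>M\<close>, and these
  values determine both stem components on the whole sphere.\<close>

lemma extension_unique:
  assumes \<Omega>: "openin (top_of_set M) \<Omega>"
    and g: "slice_regular_on g (symmetric_completion \<Omega>)" "\<forall>x\<in>\<Omega>. g x = f x"
    and h: "slice_regular_on h (symmetric_completion \<Omega>)" "\<forall>x\<in>\<Omega>. h x = f x"
    and x: "x \<in> symmetric_completion \<Omega>"
  shows "g x = h x"
proof -
  obtain D F where D: "\<And>J z. J \<in> imag_units \<Longrightarrow> slice_point J z \<in> \<Omega> \<Longrightarrow> z \<in> D"
    and F: "\<And>J z. J \<in> imag_units \<Longrightarrow> z \<in> D \<Longrightarrow> g (slice_point J z) = fst (F z) + J * snd (F z)"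
    by (rule slice_regular_on_completionE[OF g(1)]) blast
  obtain E H where E: "\<And>J z. J \<in> imag_units \<Longrightarrow> slice_point J z \<in> \<Omega> \<Longrightarrow> z \<in> E"
    and H: "\<And>J z. J \<in> imag_units \<Longrightarrow> z \<in> E \<Longrightarrow> h (slice_point J z) = fst (H z) + J * snd (H z)"
    by (rule slice_regular_on_completionE[OF h(1)]) blast
  obtain J K z where K: "K \<in> imag_units" "x = slice_point K z"
    and J: "J \<in> imag_units" "slice_point J z \<in> \<Omega>"
    using x unfolding symmetric_completion_eq_circularization circularization_def by blast
  obtain J0 J1 where J01: "J0 \<in> M \<inter> imag_units" "J1 \<in> M \<inter> imag_units" "J0 \<noteq> J1"
    "slice_point J0 z \<in> \<Omega>" "slice_point J1 z \<in> \<Omega>"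
    by (rule two_imag_units[OF \<Omega> J])
  have z: "z \<in> D" "z \<in> E" using D[OF J] E[OF J] .
  have "fst (F z) + L * snd (F z) = fst (H z) + L * snd (H z)"
    if "L \<in> M \<inter> imag_units" "slice_point L z \<in> \<Omega>" for L
  proof -
    have "L \<in> imag_units" using that by blast
    then show ?thesis
      using F[of L z] H[of L z] z g(2) h(2) that(2) by simp
  qed
  then have "fst (F z) = fst (H z)" "snd (F z) = snd (H z)"
    using stem_values_unique[OF J01(1-3)] J01 by blast+
  then show ?thesis
    using F[OF K(1) z(1)] H[OF K(1) z(2)] by (simp add: K(2))
qed

end

theorem theorem16:
  fixes M \<Omega> :: "'a::alternative_star_algebra set"
    and v :: "nat \<Rightarrow> 'a"
    and f :: "'a \<Rightarrow> 'a"
  assumes "hypercomplex_subspace M"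
    and "orthonormal_basis_of M v"
    and "openin (top_of_set M) \<Omega>"
    and "C1_on M f \<Omega>"
    and "\<not> (\<forall>x y z :: 'a. (x * y) * z = x * (y * z)) \<Longrightarrow>
           admissible M v \<Omega> f \<and> admissible M v \<Omega> (\<lambda>x. x * f x)"
  shows "(strongly_slice_regular M v \<Omega> f \<longleftrightarrow>
           (\<exists>g. slice_regular_on g (symmetric_completion \<Omega>) \<and> (\<forall>x\<in>\<Omega>. g x = f x))) \<and>
         (\<forall>g h. slice_regular_on g (symmetric_completion \<Omega>) \<and> (\<forall>x\<in>\<Omega>. g x = f x) \<and>
                slice_regular_on h (symmetric_completion \<Omega>) \<and> (\<forall>x\<in>\<Omega>. h x = f x) \<longrightarrow>
                (\<forall>x\<in>symmetric_completion \<Omega>. g x = h x))"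
proof -
  interpret hypercomplex M v
    using assms(1,2) by unfold_locales
  show ?thesis
    using strongly_slice_regular_extends[OF assms(3)] extends_strongly_slice_regular[OF assms(3,4)]
      extension_unique[OF assms(3)] by blast
qed

end
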